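(* Assume the hypotheses (A1)--(A4) of the context on $u_0$, $F$, $B$, $Q$. Consider the parareal algorithm for the stochastic Maxwell equations on $[0,T]$ with $N$ coarse intervals of length $\Delta T$ ($N\Delta T=T$), in which the coarse propagator $\mathcal{G}$ is the stochastic exponential integrator with step $\Delta T$ and the fine propagator $\mathcal{F}$ is the stochastic exponential integrator with step $\Delta t=\Delta T/J$. Then for each fixed iteration number $k$, $$\sup_{1\le n\le N}\left\|u_n^{(k)}-u_n^{ref}\right\|_{L_2(\Omega,\mathbb{H})}\le C_{T,N}\,\Delta T^{k/2}\,\sup_{1\le n\le N}\left\|u_n^{(0)}-u_n^{ref}\right\|_{L_2(\Omega,\mathbb{H})},$$ with a positive constant $C_{T,N}$ (the subscripts indicate possible dependence on $T$ and $N$) independent of $\Delta T$. Here $u_n^{(k)}$ is the parareal solution and $u_n^{ref}$ is the reference solution generated by the fine propagator, $u_0^{ref}=u_0$, $u_n^{ref}=\mathcal F(t_{n-1},t_n,u_{n-1}^{ref})$.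
   Context: **Equation.** $D\subset\mathbb{R}^3$ is a spatial domain, and $\varepsilon,\mu\in L^\infty(D)$ are bounded and uniformly positive. $\mathbb{H}:=L^2(D)^3\times L^2(D)^3$ has inner product $\langle(\bm E_1,\bm H_1),(\bm E_2,\bm H_2)\rangle_{\mathbb H}=\int_D(\varepsilon \bm E_1\cdot \bm E_2+\mu \bm H_1\cdot \bm H_2)\,d\bm x$ and the induced norm. The Maxwell operator is $M(\bm E,\bm H)=(\varepsilon^{-1}\nabla\times \bm H,\,-\mu^{-1}\nabla\times \bm E)$ with domain $\mathcal{D}(M)=\{(\bm E,\bm H)\in\mathbb H: M(\bm E,\bm H)\in\mathbb H,\ \bm n\times \bm E|_{\partial D}=0\}$, where $\bm n$ is the normal on $\partial D$; it is skew-adjoint on $\mathbb H$. $\sigma\ge 0$ is a constant and $\widehat S(t)=e^{t(M-\sigma Id)}$ is the $C_0$-semigroup generated by $M-\sigma Id$. On a filtered probability space $(\Omega,\mathscr F,P,\{\mathscr F_t\}_{t\in[0,T]})$, $W(t)=\sum_{n\ge1}\lambda_n^{1/2}\beta_n(t)e_n$ is a $Q$-Wiener process, where the $\beta_n$ are independent standard real Wiener processes, $\{e_n\}$ is a complete orthonormal system of $\mathbb H$, and $Qe_n=\lambda_ne_n$, $\lambda_n\ge0$, with $Q$ symmetric, nonnegative, $\mathrm{Tr}(Q)<\infty$. Set $U_0:=Q^{1/2}\mathbb H$. $HS(U_0,\mathbb H)$ denotes the Hilbert–Schmidt operators from $U_0$ to $\mathbb H$, and $\|Q^{1/2}\|_{HS}$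 is the Hilbert–Schmidt norm of $Q^{1/2}$ on $\mathbb H$. The norm on $L_2(\Omega,\mathbb H)$ is $\|v\|_{L_2(\Omega,\mathbb H)}=(E\|v\|_{\mathbb H}^2)^{1/2}$. The stochastic Maxwell equations are $$du(t)=[Mu(t)-\sigma u(t)]dt+F(t,u(t))dt+B(t,u(t))dW(t),\quad t\in(0,T],\qquad u(0)=u_0.$$ **Hypotheses.** $C$ denotes a constant. (A1) $u_0$ is $\mathscr F_0$-measurable and $\|u_0\|^2_{L_2(\Omega,\mathbb H)}<\infty$. (A2) For all $t,s\in[0,T]$, $u,v,h\in\mathbb H$: $\|F(t,u)\|_{\mathbb H}\le C(1+\|u\|_{\mathbb H})$; $\|F(t,u)-F(s,v)\|_{\mathbb H}\le C(|t-s|+\|u-v\|_{\mathbb H})$; and the Fréchet derivative of $F$ in $u$ satisfies $\|DF(u).h\|_{\mathbb H}\le C\|h\|_{\mathbb H}$. (A3) For all $t,s\in[0,T]$, $u,v,h\in\mathbb H$: $\|B(t,u)\|_{HS(U_0,\mathbb H)}\le C\|Q^{1/2}\|_{HS}(1+\|u\|_{\mathbb H}^2)^{1/2}$; $\|B(t,u)-B(s,v)\|_{HS(U_0,\mathbb H)}\le C\|Q^{1/2}\|_{HS}(|t-s|+\|u-v\|_{\mathbb H})$; and the Fréchet derivative of $B$ in $u$ satisfies $\|DB(u).h\|_{HS(U_0,\mathbb H)}\le C\|Q^{1/2}\|_{HS}\|h\|_{\mathbb H}$. (A4) $\|M^{(\beta-1)/2}Q^{1/2}\|_{\mathcal L_2(\mathbb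 H)}<\infty$, $\beta\in[0,1]$, where $\mathcal L_2(\mathbb H)$ denotes Hilbert–Schmidt operators on $\mathbb H$ and $M^{(\beta-1)/2}$ is the fractional power of $M$; the case of main interest is $\beta=1$ (trace-class $Q$). **Parareal algorithm.** Let $t_n=n\Delta T$, $n=0,\dots,N$, and $\Delta W_n=W(t_n)-W(t_{n-1})$. Each $[t_{n-1},t_n]$ is divided into $J$ subintervals $[t_{n-1,j-1},t_{n-1,j}]$, $j=1,\dots,J$, of length $\Delta t=\Delta T/J$, with $t_{n-1,j}=t_{n-1}+j\Delta t$. Coarse propagator: $\mathcal G(t_{n-1},t_n,u)=\widehat S(\Delta T)u+\widehat S(\Delta T)F(t_{n-1},u)\Delta T+\widehat S(\Delta T)B(t_{n-1},u)\Delta W_n$. Fine propagator: one fine step is $\mathcal F(t_{n-1,j-1},t_{n-1,j},u)=\widehat S(\Delta t)u+\widehat S(\Delta t)F(t_{n-1,j-1},u)\Delta t+\widehat S(\Delta t)B(t_{n-1,j-1},u)\,(W(t_{n-1,j})-W(t_{n-1,j-1}))$, and $\mathcal F(t_{n-1},t_n,u)$ is the result of composing the $J$ fine steps $j=1,\dots,J$ starting from $u$. Initialization: $u_0^{(0)}=u_0$, $u_n^{(0)}=\mathcal G(t_{n-1},t_n,u_{n-1}^{(0)})$ for $n=1,\dots,N$. Iteration: $u_0^{(k)}=u_0$ for all $k$, and for $k\ge0$, $n=1,\dots,N$, $$u_n^{(k+1)}=\mathcal G(t_{n-1},t_n,u_{n-1}^{(k+1)})+\mathcal F(t_{n-1},t_n,u_{n-1}^{(k)})-\mathcal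 G(t_{n-1},t_n,u_{n-1}^{(k)}).$$ *)

theory Defs
  imports "HOL-Probability.Probability"
begin

section \<open>Square-integrable fields, weak curl, tangential trace\<close>

definition L2_field :: "(real^3) set \<Rightarrow> (real^3 \<Rightarrow> real^3) \<Rightarrow> bool" where
  "L2_field D f \<longleftrightarrow> f \<in> borel_measurable (lebesgue_on D) \<and>
     integrable (lebesgue_on D) (\<lambda>x. (norm (f x))\<^sup>2)"

definition bounded_positive_coeff :: "(real^3) set \<Rightarrow> (real^3 \<Rightarrow> real) \<Rightarrow> bool" where
  "bounded_positive_coeff D c \<longleftrightarrow> c \<in> borel_measurable (lebesgue_on D) \<and>
     (\<exists>a b. 0 < a \<and> (AE x in lebesgue_on D. a \<le> c x \<and> c x \<le> b))"

definition partial_deriv :: "3 \<Rightarrow> (real^3 \<Rightarrow> real^3) \<Rightarrow> real^3 \<Rightarrow> real^3" where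
  "partial_deriv i f x = frechet_derivative f (at x) (axis i 1)"

primrec C_times :: "nat \<Rightarrow> (real^3 \<Rightarrow> real^3) \<Rightarrow> bool" where
  "C_times 0 f \<longleftrightarrow> continuous_on UNIV f"
| "C_times (Suc k) f \<longleftrightarrow> (\<forall>x. f differentiable (at x)) \<and> (\<forall>i. C_times k (partial_deriv i f))"

definition test_field :: "(real^3) set \<Rightarrow> (real^3 \<Rightarrow> real^3) \<Rightarrow> bool" where
  "test_field D \<phi> \<longleftrightarrow> (\<forall>k. C_times k \<phi>) \<and> (\<exists>K. compact K \<and> K \<subseteq> D \<and> (\<forall>x. x \<notin> K \<longrightarrow> \<phi> x = 0))"

definition curl :: "(real^3 \<Rightarrow> real^3) \<Rightarrow> real^3 \<Rightarrow> real^3" where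
  "curl f x = vector
     [partial_deriv 2 f x $ 3 - partial_deriv 3 f x $ 2,
      partial_deriv 3 f x $ 1 - partial_deriv 1 f x $ 3,
      partial_deriv 1 f x $ 2 - partial_deriv 2 f x $ 1]"

text \<open>\<open>weak_curl D f g\<close>: the field \<open>f\<close> lies in \<open>H(curl, D)\<close>, and \<open>g\<close> is its distributional curl.\<close>

definition weak_curl :: "(real^3) set \<Rightarrow> (real^3 \<Rightarrow> real^3) \<Rightarrow> (real^3 \<Rightarrow> real^3) \<Rightarrow> bool" where
  "weak_curl D f g \<longleftrightarrow> L2_field D f \<and> L2_field D g \<and>
     (\<forall>\<phi>. test_field D \<phi> \<longrightarrow>
        (\<integral>x. g x \<bullet> \<phi> x \<partial>lebesgue_on D) = (\<integral>x. f x \<bullet> curl \<phi> x \<partial>lebesgue_on D))"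

text \<open>A field in \<open>H(curl, D)\<close> has no pointwise boundary values.  Its tangential trace \<open>n \<times> f\<close> on
  the boundary is the functional given by Green's formula,
  \<open>\<langle>n \<times> f, g\<rangle> = \<integral> curl f \<bullet> g - \<integral> f \<bullet> curl g\<close>.  Testing with all of \<open>H(curl, D)\<close>
  needs no regularity of the boundary.\<close>

definition tangential_trace_zero :: "(real^3) set \<Rightarrow> (real^3 \<Rightarrow> real^3) \<Rightarrow> bool" where
  "tangential_trace_zero D f \<longleftrightarrow>
     (\<forall>cf g cg. weak_curl D f cf \<longrightarrow> weak_curl D g cg \<longrightarrow>
        (\<integral>x. cf x \<bullet> g x \<partial>lebesgue_on D) - (\<integral>x. f x \<bullet> cg x \<partial>lebesgue_on D) = 0)"


section \<open>The space of electromagnetic fields and the Maxwell operator\<close>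

text \<open>The space of classes of pairs of square-integrable fields on \<open>D\<close> depends on \<open>D\<close>, \<open>\<epsilon>\<close>, \<open>\<mu>\<close>, so it
  cannot be a type constructed once and for all.  Instead it is any type \<open>'h\<close> together with maps \<open>E\<close>, \<open>H\<close>
  choosing representatives of the electric and the magnetic component: modulo equality almost
  everywhere, \<open>(E, H)\<close> is a linear bijection of \<open>'h\<close> onto the pairs of \<open>L\<^sup>2\<close> fields, and the
  inner product of \<open>'h\<close> is the weighted one.\<close>

definition em_space ::
  "(real^3) set \<Rightarrow> (real^3 \<Rightarrow> real) \<Rightarrow> (real^3 \<Rightarrow> real) \<Rightarrow>
   ('h::real_inner \<Rightarrow> real^3 \<Rightarrow> real^3) \<Rightarrow> ('h \<Rightarrow> real^3 \<Rightarrow> real^3) \<Rightarrow> bool" where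
  "em_space D \<epsilon> \<mu> E H \<longleftrightarrow>
     (\<forall>u. L2_field D (E u) \<and> L2_field D (H u)) \<and>
     (\<forall>f g. L2_field D f \<longrightarrow> L2_field D g \<longrightarrow>
        (\<exists>!u. AE x in lebesgue_on D. E u x = f x \<and> H u x = g x)) \<and>
     (\<forall>u v. AE x in lebesgue_on D. E (u + v) x = E u x + E v x \<and> H (u + v) x = H u x + H v x) \<and>
     (\<forall>c u. AE x in lebesgue_on D. E (c *\<^sub>R u) x = c *\<^sub>R E u x \<and> H (c *\<^sub>R u) x = c *\<^sub>R H u x) \<and>
     (\<forall>u v. u \<bullet> v =
        (\<integral>x. \<epsilon> x * (E u x \<bullet> E v x) + \<mu> x * (H u x \<bullet> H v x) \<partial>lebesgue_on D))"

text \<open>Unbounded operators are given by their graphs.\<close>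

definition maxwell ::
  "(real^3) set \<Rightarrow> (real^3 \<Rightarrow> real) \<Rightarrow> (real^3 \<Rightarrow> real) \<Rightarrow>
   ('h::real_inner \<Rightarrow> real^3 \<Rightarrow> real^3) \<Rightarrow> ('h \<Rightarrow> real^3 \<Rightarrow> real^3) \<Rightarrow> ('h \<times> 'h) set" where
  "maxwell D \<epsilon> \<mu> E H =
     {(u, v). tangential_trace_zero D (E u) \<and>
        (\<exists>cE cH. weak_curl D (E u) cE \<and> weak_curl D (H u) cH \<and>
           (AE x in lebesgue_on D.
              E v x = inverse (\<epsilon> x) *\<^sub>R cH x \<and> H v x = - (inverse (\<mu> x) *\<^sub>R cE x)))}"

definition minus_scalar :: "('h \<times> 'h) set \<Rightarrow> real \<Rightarrow> ('h::real_vector \<times> 'h) set" where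
  "minus_scalar A \<sigma> = {(u, v - \<sigma> *\<^sub>R u) | u v. (u, v) \<in> A}"


section \<open>Strongly continuous semigroups and fractional powers\<close>

definition C0_semigroup :: "(real \<Rightarrow> 'h \<Rightarrow> 'h::real_normed_vector) \<Rightarrow> bool" where
  "C0_semigroup S \<longleftrightarrow> (\<forall>t\<ge>0. bounded_linear (S t)) \<and> (\<forall>u. S 0 u = u) \<and>
     (\<forall>s\<ge>0. \<forall>t\<ge>0. \<forall>u. S (s + t) u = S s (S t u)) \<and>
     (\<forall>u. ((\<lambda>t. S t u) \<longlongrightarrow> u) (at_right 0))"

definition generator :: "(real \<Rightarrow> 'h \<Rightarrow> 'h) \<Rightarrow> ('h::real_normed_vector \<times> 'h) set" where
  "generator S = {(u, v). ((\<lambda>h. (S h u - u) /\<^sub>R h) \<longlongrightarrow> v) (at_right 0)}"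

text \<open>\<open>resolvent_at A l x = (l + A)\<^sup>-\<^sup>1 x\<close>\<close>

definition resolvent_at :: "('h \<times> 'h) set \<Rightarrow> real \<Rightarrow> 'h::real_vector \<Rightarrow> 'h" where
  "resolvent_at A l x = (THE y. \<exists>z. (y, z) \<in> A \<and> l *\<^sub>R y + z = x)"

text \<open>Graph of the power of \<open>A\<close> with exponent \<open>-a\<close>, \<open>0 \<le> a < 1\<close>, by Balakrishnan's formula
  \<open>sin (\<pi> a) / \<pi> * \<integral>\<^sub>0\<^sup>\<infinity> l powr (-a) * (l + A)\<^sup>-\<^sup>1 dl\<close>; the domain consists of the vectors for
  which the improper integral converges.\<close>

definition neg_power :: "('h \<times> 'h) set \<Rightarrow> real \<Rightarrow> ('h::real_normed_vector \<times> 'h) set" where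
  "neg_power A a =
     (if a = 0 then Id
      else {(x, y). ((\<lambda>r. (sin (pi * a) / pi) *\<^sub>R
               integral {1 / r .. r} (\<lambda>l. l powr (- a) *\<^sub>R resolvent_at A l x)) \<longlongrightarrow> y) at_top})"


section \<open>Covariance operator and Hilbert-Schmidt operators\<close>

definition complete_orthonormal :: "(nat \<Rightarrow> 'h::real_inner) \<Rightarrow> bool" where
  "complete_orthonormal e \<longleftrightarrow> (\<forall>m n. e m \<bullet> e n = (if m = n then 1 else 0)) \<and>
     closure (span (range e)) = UNIV"

definition covariance_operator ::
  "(nat \<Rightarrow> 'h::real_inner) \<Rightarrow> (nat \<Rightarrow> real) \<Rightarrow> ('h \<Rightarrow> 'h) \<Rightarrow> bool" where
  "covariance_operator e lam Q \<longleftrightarrow> bounded_linear Q \<and>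
     (\<forall>x y. Q x \<bullet> y = x \<bullet> Q y) \<and> (\<forall>x. 0 \<le> Q x \<bullet> x) \<and>
     (\<forall>n. 0 \<le> lam n \<and> Q (e n) = lam n *\<^sub>R e n) \<and> summable (\<lambda>n. Q (e n) \<bullet> e n)"

definition sqrt_op :: "(nat \<Rightarrow> 'h::real_inner) \<Rightarrow> (nat \<Rightarrow> real) \<Rightarrow> 'h \<Rightarrow> 'h" where
  "sqrt_op e lam x = (\<Sum>n. (sqrt (lam n) * (x \<bullet> e n)) *\<^sub>R e n)"

definition hilbert_schmidt :: "(nat \<Rightarrow> 'h::real_inner) \<Rightarrow> ('h \<Rightarrow> 'h) \<Rightarrow> bool" where
  "hilbert_schmidt e A \<longleftrightarrow> bounded_linear A \<and> summable (\<lambda>n. (norm (A (e n)))\<^sup>2)"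

definition hs_norm :: "(nat \<Rightarrow> 'h::real_inner) \<Rightarrow> ('h \<Rightarrow> 'h) \<Rightarrow> real" where
  "hs_norm e A = sqrt (\<Sum>n. (norm (A (e n)))\<^sup>2)"

text \<open>\<open>U\<^sub>0\<close>, the range of \<open>Q\<^sup>1\<^sup>/\<^sup>2\<close>, carries the norm that makes \<open>Q\<^sup>1\<^sup>/\<^sup>2\<close> a partial isometry onto it.  Hence
  \<open>\<Phi>\<close> is Hilbert-Schmidt on \<open>U\<^sub>0\<close> iff \<open>\<Phi> \<circ> Q\<^sup>1\<^sup>/\<^sup>2\<close> is Hilbert-Schmidt on the whole space, with the same norm.
  An operator on \<open>U\<^sub>0\<close> is a total function whose values outside \<open>U\<^sub>0\<close> are irrelevant.\<close>

definition U0 :: "(nat \<Rightarrow> 'h::real_inner) \<Rightarrow> (nat \<Rightarrow> real) \<Rightarrow> 'h set" where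
  "U0 e lam = range (sqrt_op e lam)"

definition HS0 :: "(nat \<Rightarrow> 'h::real_inner) \<Rightarrow> (nat \<Rightarrow> real) \<Rightarrow> ('h \<Rightarrow> 'h) set" where
  "HS0 e lam = {\<Phi>. (\<forall>x\<in>U0 e lam. \<forall>y\<in>U0 e lam. \<Phi> (x + y) = \<Phi> x + \<Phi> y) \<and>
     (\<forall>c. \<forall>x\<in>U0 e lam. \<Phi> (c *\<^sub>R x) = c *\<^sub>R \<Phi> x) \<and> hilbert_schmidt e (\<Phi> \<circ> sqrt_op e lam)}"

definition hs0_norm :: "(nat \<Rightarrow> 'h::real_inner) \<Rightarrow> (nat \<Rightarrow> real) \<Rightarrow> ('h \<Rightarrow> 'h) \<Rightarrow> real" where
  "hs0_norm e lam \<Phi> = hs_norm e (\<Phi> \<circ> sqrt_op e lam)"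


section \<open>Wiener processes\<close>

definition filtration_on :: "'w measure \<Rightarrow> real \<Rightarrow> (real \<Rightarrow> 'w measure) \<Rightarrow> bool" where
  "filtration_on P T \<FF> \<longleftrightarrow> (\<forall>t\<in>{0..T}. subalgebra P (\<FF> t)) \<and>
     (\<forall>s t. 0 \<le> s \<longrightarrow> s \<le> t \<longrightarrow> t \<le> T \<longrightarrow> sets (\<FF> s) \<subseteq> sets (\<FF> t))"

definition standard_wiener :: "'w measure \<Rightarrow> real \<Rightarrow> (real \<Rightarrow> 'w \<Rightarrow> real) \<Rightarrow> bool" where
  "standard_wiener P T b \<longleftrightarrow>
     (\<forall>t\<in>{0..T}. b t \<in> borel_measurable P) \<and>
     (AE \<omega> in P. b 0 \<omega> = 0) \<and>
     (\<forall>s t. 0 \<le> s \<longrightarrow> s < t \<longrightarrow> t \<le> T \<longrightarrow>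
        distributed P lborel (\<lambda>\<omega>. b t \<omega> - b s \<omega>) (\<lambda>x. ennreal (normal_density 0 (sqrt (t - s)) x))) \<and>
     (\<forall>m \<tau>. 0 \<le> \<tau> 0 \<longrightarrow> (\<forall>i<m. \<tau> i \<le> \<tau> (Suc i)) \<longrightarrow> \<tau> m \<le> T \<longrightarrow>
        prob_space.indep_vars P (\<lambda>_. borel) (\<lambda>i \<omega>. b (\<tau> (Suc i)) \<omega> - b (\<tau> i) \<omega>) {..<m::nat}) \<and>
     (AE \<omega> in P. continuous_on {0..T} (\<lambda>t. b t \<omega>))"

definition independent_processes :: "'w measure \<Rightarrow> real \<Rightarrow> (nat \<Rightarrow> real \<Rightarrow> 'w \<Rightarrow> real) \<Rightarrow> bool" where
  "independent_processes P T \<beta> \<longleftrightarrow>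
     prob_space.indep_vars P (\<lambda>_. \<Pi>\<^sub>M t\<in>{0..T}. borel) (\<lambda>n \<omega>. \<lambda>t\<in>{0..T}. \<beta> n t \<omega>) UNIV"

text \<open>A \<open>Q\<close>-Wiener process with respect to a filtration: adapted, increments independent of the past,
  and the mean-square sum of its Karhunen-Loeve series.\<close>

definition Q_wiener ::
  "'w measure \<Rightarrow> real \<Rightarrow> (real \<Rightarrow> 'w measure) \<Rightarrow> (nat \<Rightarrow> 'h::real_inner) \<Rightarrow> (nat \<Rightarrow> real) \<Rightarrow>
   (nat \<Rightarrow> real \<Rightarrow> 'w \<Rightarrow> real) \<Rightarrow> (real \<Rightarrow> 'w \<Rightarrow> 'h) \<Rightarrow> bool" where
  "Q_wiener P T \<FF> e lam \<beta> W \<longleftrightarrow>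
     (\<forall>n. standard_wiener P T (\<beta> n)) \<and> independent_processes P T \<beta> \<and>
     (\<forall>t\<in>{0..T}. W t \<in> borel_measurable (\<FF> t)) \<and>
     (\<forall>s t. 0 \<le> s \<longrightarrow> s \<le> t \<longrightarrow> t \<le> T \<longrightarrow>
        prob_space.indep_set P (sets (\<FF> s))
          {(\<lambda>\<omega>. W t \<omega> - W s \<omega>) -` A \<inter> space P | A. A \<in> sets borel}) \<and>
     (\<forall>t\<in>{0..T}. (\<lambda>m. \<integral>\<^sup>+\<omega>. ennreal ((norm (W t \<omega> -
          (\<Sum>n<m. (sqrt (lam n) * \<beta> n t \<omega>) *\<^sub>R e n)))\<^sup>2) \<partial>P) \<longlonglongrightarrow> 0)"

definition square_integrable_rv :: "'w measure \<Rightarrow> ('w \<Rightarrow> 'h::real_normed_vector) \<Rightarrow> bool" where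
  "square_integrable_rv P v \<longleftrightarrow>
     v \<in> borel_measurable P \<and> integrable P (\<lambda>\<omega>. (norm (v \<omega>))\<^sup>2)"

definition L2_norm :: "'w measure \<Rightarrow> ('w \<Rightarrow> 'h::real_normed_vector) \<Rightarrow> real" where
  "L2_norm P v = sqrt (\<integral>\<omega>. (norm (v \<omega>))\<^sup>2 \<partial>P)"


section \<open>Hypotheses on the data\<close>

definition hyp_A1 :: "'w measure \<Rightarrow> (real \<Rightarrow> 'w measure) \<Rightarrow> ('w \<Rightarrow> 'h::real_normed_vector) \<Rightarrow> bool" where
  "hyp_A1 P \<FF> u0 \<longleftrightarrow> u0 \<in> borel_measurable (\<FF> 0) \<and> square_integrable_rv P u0"

definition hyp_A2 :: "real \<Rightarrow> real \<Rightarrow> (real \<Rightarrow> 'h \<Rightarrow> 'h::real_normed_vector) \<Rightarrow> bool" where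
  "hyp_A2 T C F \<longleftrightarrow>
     (\<forall>t\<in>{0..T}. \<forall>u. norm (F t u) \<le> C * (1 + norm u)) \<and>
     (\<forall>t\<in>{0..T}. \<forall>s\<in>{0..T}. \<forall>u v. norm (F t u - F s v) \<le> C * (\<bar>t - s\<bar> + norm (u - v))) \<and>
     (\<forall>t\<in>{0..T}. \<forall>u. \<exists>DF. (F t has_derivative DF) (at u) \<and> (\<forall>h. norm (DF h) \<le> C * norm h))"

text \<open>The last clause is Frechet differentiability of \<open>B t\<close> as a map into the space \<open>HS0 e lam\<close>.\<close>

definition hyp_A3 ::
  "(nat \<Rightarrow> 'h::real_inner) \<Rightarrow> (nat \<Rightarrow> real) \<Rightarrow> real \<Rightarrow> real \<Rightarrow> (real \<Rightarrow> 'h \<Rightarrow> 'h \<Rightarrow> 'h) \<Rightarrow> bool" where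
  "hyp_A3 e lam T C B \<longleftrightarrow>
     (\<forall>t\<in>{0..T}. \<forall>u. B t u \<in> HS0 e lam \<and>
        hs0_norm e lam (B t u) \<le> C * hs_norm e (sqrt_op e lam) * sqrt (1 + (norm u)\<^sup>2)) \<and>
     (\<forall>t\<in>{0..T}. \<forall>s\<in>{0..T}. \<forall>u v. hs0_norm e lam (\<lambda>x. B t u x - B s v x)
        \<le> C * hs_norm e (sqrt_op e lam) * (\<bar>t - s\<bar> + norm (u - v))) \<and>
     (\<forall>t\<in>{0..T}. \<forall>u. \<exists>DB.
        (\<forall>h. DB h \<in> HS0 e lam \<and>
           hs0_norm e lam (DB h) \<le> C * hs_norm e (sqrt_op e lam) * norm h) \<and>
        (\<forall>x\<in>U0 e lam. linear (\<lambda>h. DB h x)) \<and>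
        ((\<lambda>h. hs0_norm e lam (\<lambda>x. B t (u + h) x - B t u x - DB h x) / norm h) \<longlongrightarrow> 0) (at 0))"

definition hyp_A4 ::
  "('h \<times> 'h) set \<Rightarrow> (nat \<Rightarrow> 'h::real_inner) \<Rightarrow> (nat \<Rightarrow> real) \<Rightarrow> real \<Rightarrow> bool" where
  "hyp_A4 M e lam b \<longleftrightarrow>
     (\<exists>A. (\<forall>x. (sqrt_op e lam x, A x) \<in> neg_power M ((1 - b) / 2)) \<and> hilbert_schmidt e A)"


section \<open>Exponential integrator and parareal iteration\<close>

text \<open>An increment \<open>dW\<close> of the Wiener process does not take values in \<open>U\<^sub>0\<close>, so \<open>\<Phi> dW\<close> is not a pointwise
  application: it is the mean-square limit of \<open>\<Phi>\<close> applied to the truncations of \<open>dW\<close>, which do lie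
  in \<open>U\<^sub>0\<close>.  (Where the limit exists it is unique up to null sets.)  The sigma-algebra \<open>G\<close> is that of
  the end of the time step.\<close>

definition U0_truncation :: "(nat \<Rightarrow> 'h::real_inner) \<Rightarrow> (nat \<Rightarrow> real) \<Rightarrow> nat \<Rightarrow> 'h \<Rightarrow> 'h" where
  "U0_truncation e lam m x = (\<Sum>n | n < m \<and> 0 < lam n. (x \<bullet> e n) *\<^sub>R e n)"

definition apply_to_increment ::
  "'w measure \<Rightarrow> 'w measure \<Rightarrow> (nat \<Rightarrow> 'h::real_inner) \<Rightarrow> (nat \<Rightarrow> real) \<Rightarrow>
   ('w \<Rightarrow> 'h \<Rightarrow> 'h) \<Rightarrow> ('w \<Rightarrow> 'h) \<Rightarrow> 'w \<Rightarrow> 'h" where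
  "apply_to_increment P G e lam \<Phi> dW = (SOME Y. Y \<in> borel_measurable G \<and>
     (\<lambda>m. \<integral>\<^sup>+\<omega>. ennreal ((norm (Y \<omega> - \<Phi> \<omega> (U0_truncation e lam m (dW \<omega>))))\<^sup>2) \<partial>P) \<longlonglongrightarrow> 0)"

definition exp_step ::
  "'w measure \<Rightarrow> (real \<Rightarrow> 'w measure) \<Rightarrow> (nat \<Rightarrow> 'h::real_inner) \<Rightarrow> (nat \<Rightarrow> real) \<Rightarrow>
   (real \<Rightarrow> 'w \<Rightarrow> 'h) \<Rightarrow> (real \<Rightarrow> 'h \<Rightarrow> 'h) \<Rightarrow> (real \<Rightarrow> 'h \<Rightarrow> 'h) \<Rightarrow> (real \<Rightarrow> 'h \<Rightarrow> 'h \<Rightarrow> 'h) \<Rightarrow>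
   real \<Rightarrow> real \<Rightarrow> ('w \<Rightarrow> 'h) \<Rightarrow> 'w \<Rightarrow> 'h" where
  "exp_step P \<FF> e lam W S F B s t u =
     (let N = apply_to_increment P (\<FF> t) e lam (\<lambda>\<omega>. B s (u \<omega>)) (\<lambda>\<omega>. W t \<omega> - W s \<omega>)
      in (\<lambda>\<omega>. S (t - s) (u \<omega>) + (t - s) *\<^sub>R S (t - s) (F s (u \<omega>)) + S (t - s) (N \<omega>)))"

text \<open>A propagator is indexed by \<open>n\<close> for the interval from \<open>n \<Delta>T\<close> to \<open>(n + 1) \<Delta>T\<close>; its argument
  \<open>step s t\<close> is a one-step method from time \<open>s\<close> to time \<open>t\<close>.\<close>

definition coarse_prop :: "(real \<Rightarrow> real \<Rightarrow> 'u \<Rightarrow> 'u) \<Rightarrow> real \<Rightarrow> nat \<Rightarrow> 'u \<Rightarrow> 'u" where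
  "coarse_prop step dT n u = step (real n * dT) (real (Suc n) * dT) u"

primrec fine_steps :: "(real \<Rightarrow> real \<Rightarrow> 'u \<Rightarrow> 'u) \<Rightarrow> real \<Rightarrow> real \<Rightarrow> nat \<Rightarrow> 'u \<Rightarrow> 'u" where
  "fine_steps step t0 dt 0 u = u"
| "fine_steps step t0 dt (Suc j) u =
     step (t0 + real j * dt) (t0 + real (Suc j) * dt) (fine_steps step t0 dt j u)"

definition fine_prop :: "(real \<Rightarrow> real \<Rightarrow> 'u \<Rightarrow> 'u) \<Rightarrow> real \<Rightarrow> nat \<Rightarrow> nat \<Rightarrow> 'u \<Rightarrow> 'u" where
  "fine_prop step dT J n u = fine_steps step (real n * dT) (dT / real J) J u"

fun parareal ::
  "(nat \<Rightarrow> ('w \<Rightarrow> 'h) \<Rightarrow> 'w \<Rightarrow> 'h) \<Rightarrow> (nat \<Rightarrow> ('w \<Rightarrow> 'h) \<Rightarrow> 'w \<Rightarrow> 'h) \<Rightarrow> ('w \<Rightarrow> 'h::ab_group_add) \<Rightarrow>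
   nat \<Rightarrow> nat \<Rightarrow> 'w \<Rightarrow> 'h" where
  "parareal \<G> \<F> u0 k 0 = u0"
| "parareal \<G> \<F> u0 0 (Suc n) = \<G> n (parareal \<G> \<F> u0 0 n)"
| "parareal \<G> \<F> u0 (Suc k) (Suc n) =
     (\<lambda>\<omega>. \<G> n (parareal \<G> \<F> u0 (Suc k) n) \<omega> + \<F> n (parareal \<G> \<F> u0 k n) \<omega>
        - \<G> n (parareal \<G> \<F> u0 k n) \<omega>)"

primrec reference :: "(nat \<Rightarrow> ('w \<Rightarrow> 'h) \<Rightarrow> 'w \<Rightarrow> 'h) \<Rightarrow> ('w \<Rightarrow> 'h) \<Rightarrow> nat \<Rightarrow> 'w \<Rightarrow> 'h" where
  "reference \<F> u0 0 = u0"
| "reference \<F> u0 (Suc n) = \<F> n (reference \<F> u0 n)"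

end

theory Submission
  imports Defs
begin

text \<open>Both propagators have the form \<open>S(\<Delta>T) u\<close> plus increments that are Lipschitz in \<open>u\<close> with a
  mean-square constant of order \<open>\<Delta>T powr (1/2)\<close>: the drift contributes \<open>\<Delta>T\<close>, and the noise
  contributions of the fine steps are orthogonal in \<open>L\<^sup>2\<close>, so their squares add up to \<open>\<Delta>T\<close> whatever
  the number \<open>J\<close> of fine steps.  The terms \<open>S(\<Delta>T) u\<close> cancel in the difference of the fine and the
  coarse propagator, and hence each parareal iteration gains a factor \<open>\<Delta>T powr (1/2)\<close>.\<close>

section \<open>Square-integrable random variables\<close>

text \<open>The bound \<open>M\<close> of the semigroup on \<open>{0..T}\<close> may exceed 1, so
  chaining one-step Lipschitz estimates over the \<open>J\<close> fine steps would produce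
  \<open>M ^ J\<close>. The difference of two fine trajectories is therefore unrolled into a
  discrete variation-of-constants formula, in which every drift or noise contribution is carried by
  a single operator \<open>S ((j - i) * dt)\<close>. Then \<open>M\<close> enters once per
  contribution, and a discrete Gronwall inequality for the squared mean-square error gives constants
  free of \<open>J\<close> and \<open>dT\<close>. A second obstacle is that \<open>B dW\<close> is
  not a pathwise expression: \<open>apply_to_increment\<close> chooses it as a mean-square limit.
  Truncations to finitely many modes are estimated and shown to be Cauchy, and the Lipschitz bound
  and the orthogonality to the past are passed to the limit. Running through the \<open>N\<close>
  coarse intervals costs a factor depending on \<open>N\<close>, which is why the final constant
  depends on it.\<close>

lemma square_integrable_rv_measurable[measurable_dest]:
  "square_integrable_rv P v \<Longrightarrow> v \<in> borel_measurable P"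
  by (simp add: square_integrable_rv_def)

lemma square_integrable_rv_integrable:
  "square_integrable_rv P v \<Longrightarrow> integrable P (\<lambda>\<omega>. (norm (v \<omega>))\<^sup>2)"
  by (simp add: square_integrable_rv_def)

lemma square_integrable_rv_dominated:
  fixes v :: "'w \<Rightarrow> 'h::{real_normed_vector, second_countable_topology}"
  assumes "v \<in> borel_measurable P" "integrable P g" "\<And>\<omega>. (norm (v \<omega>))\<^sup>2 \<le> g \<omega>"
  shows "square_integrable_rv P v"
proof -
  have [measurable]: "v \<in> borel_measurable P" by fact
  have "integrable P (\<lambda>\<omega>. (norm (v \<omega>))\<^sup>2)"
    by (rule Bochner_Integration.integrable_bound[OF assms(2)])
      (use assms(3) in \<open>auto intro!: AE_I2 order_trans[OF _ abs_ge_self]\<close>)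
  then show ?thesis using assms(1) by (simp add: square_integrable_rv_def)
qed

lemma norm_add_sq_le: "(norm (a + b))\<^sup>2 \<le> 2 * (norm a)\<^sup>2 + 2 * (norm (b::'h::real_normed_vector))\<^sup>2"
proof -
  have "(norm (a + b))\<^sup>2 \<le> (norm a + norm b)\<^sup>2"
    by (intro power_mono norm_triangle_ineq) auto
  also have "\<dots> \<le> 2 * (norm a)\<^sup>2 + 2 * (norm b)\<^sup>2"
    using sum_squares_bound[of "norm a" "norm b"] by (simp add: power2_sum)
  finally show ?thesis .
qed

lemma square_integrable_rv_add:
  fixes u v :: "'w \<Rightarrow> 'h::{real_normed_vector, second_countable_topology}"
  assumes u: "square_integrable_rv P u" and v: "square_integrable_rv P v"
  shows "square_integrable_rv P (\<lambda>\<omega>. u \<omega> + v \<omega>)"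
proof -
  note [measurable] = square_integrable_rv_measurable[OF u] square_integrable_rv_measurable[OF v]
  show ?thesis
    by (rule square_integrable_rv_dominated[where g="\<lambda>\<omega>. 2 * (norm (u \<omega>))\<^sup>2 + 2 * (norm (v \<omega>))\<^sup>2"])
      (auto intro: norm_add_sq_le simp: square_integrable_rv_integrable u v)
qed

lemma square_integrable_rv_bounded_linear:
  fixes u :: "'w \<Rightarrow> 'h::{real_normed_vector, second_countable_topology}"
    and R :: "'h \<Rightarrow> 'k::{real_normed_vector, second_countable_topology}"
  assumes R: "bounded_linear R" and u: "square_integrable_rv P u"
  shows "square_integrable_rv P (\<lambda>\<omega>. R (u \<omega>))"
proof -
  note [measurable] = square_integrable_rv_measurable[OF u]
  obtain K where K: "\<And>x. norm (R x) \<le> norm x * K" using bounded_linear.bounded[OF R] by blast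
  have [measurable]: "R \<in> borel_measurable borel"
    using R by (simp add: borel_measurable_continuous_onI linear_continuous_on)
  show ?thesis
  proof (rule square_integrable_rv_dominated[where g="\<lambda>\<omega>. K\<^sup>2 * (norm (u \<omega>))\<^sup>2"])
    show "(norm (R (u \<omega>)))\<^sup>2 \<le> K\<^sup>2 * (norm (u \<omega>))\<^sup>2" for \<omega>
      using power_mono[OF K, of "u \<omega>" 2] by (simp add: power_mult_distrib mult.commute)
  qed (auto simp: square_integrable_rv_integrable u)
qed

lemma square_integrable_rv_scaleR:
  fixes u :: "'w \<Rightarrow> 'h::{real_normed_vector, second_countable_topology}"
  shows "square_integrable_rv P u \<Longrightarrow> square_integrable_rv P (\<lambda>\<omega>. c *\<^sub>R u \<omega>)"
  by (rule square_integrable_rv_bounded_linear) (rule bounded_linear_scaleR_right)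

lemma square_integrable_rv_diff:
  fixes u v :: "'w \<Rightarrow> 'h::{real_normed_vector, second_countable_topology}"
  shows "square_integrable_rv P u \<Longrightarrow> square_integrable_rv P v \<Longrightarrow>
    square_integrable_rv P (\<lambda>\<omega>. u \<omega> - v \<omega>)"
  using square_integrable_rv_add[of P u "\<lambda>\<omega>. (-1) *\<^sub>R v \<omega>"] square_integrable_rv_scaleR[of P v "-1"]
  by simp

lemma square_integrable_rv_zero: "square_integrable_rv P (\<lambda>\<omega>. 0)"
  by (simp add: square_integrable_rv_def)

lemma square_integrable_rv_sum:
  fixes u :: "'i \<Rightarrow> 'w \<Rightarrow> 'h::{real_normed_vector, second_countable_topology}"
  assumes "\<And>i. i \<in> A \<Longrightarrow> square_integrable_rv P (u i)"
  shows "square_integrable_rv P (\<lambda>\<omega>. \<Sum>i\<in>A. u i \<omega>)"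
  using assms
  by (induction A rule: infinite_finite_induct)
    (auto intro: square_integrable_rv_add square_integrable_rv_zero)

section \<open>The mean-square seminorm and its basic inequalities\<close>

lemma L2_norm_nonneg[simp]: "0 \<le> L2_norm P v"
  by (simp add: L2_norm_def)

lemma L2_norm_sq: "(L2_norm P v)\<^sup>2 = (\<integral>\<omega>. (norm (v \<omega>))\<^sup>2 \<partial>P)"
  by (simp add: L2_norm_def)

lemma L2_norm_zero[simp]: "L2_norm P (\<lambda>\<omega>. 0) = 0"
  by (simp add: L2_norm_def)

lemma nn_integral_norm_sq:
  assumes "square_integrable_rv P v"
  shows "(\<integral>\<^sup>+\<omega>. ennreal ((norm (v \<omega>))\<^sup>2) \<partial>P) = ennreal ((L2_norm P v)\<^sup>2)"
  unfolding L2_norm_sq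
  by (rule nn_integral_eq_integral) (auto simp: square_integrable_rv_integrable assms)

lemma L2_norm_mono:
  assumes u: "square_integrable_rv P u" and v: "square_integrable_rv P v"
    and le: "\<And>\<omega>. norm (u \<omega>) \<le> c * norm (v \<omega>)" and "0 \<le> c"
  shows "L2_norm P u \<le> c * L2_norm P v"
proof (rule power2_le_imp_le)
  have "(L2_norm P u)\<^sup>2 \<le> (\<integral>\<omega>. c\<^sup>2 * (norm (v \<omega>))\<^sup>2 \<partial>P)"
    unfolding L2_norm_sq
    using power_mono[OF le norm_ge_zero, of _ 2]
    by (intro integral_mono square_integrable_rv_integrable[OF u] integrable_mult_right
        square_integrable_rv_integrable[OF v]) (simp add: power_mult_distrib)
  also have "\<dots> = (c * L2_norm P v)\<^sup>2"
    by (simp add: L2_norm_sq power_mult_distrib)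
  finally show "(L2_norm P u)\<^sup>2 \<le> (c * L2_norm P v)\<^sup>2" .
qed (use \<open>0 \<le> c\<close> in simp)

lemma integrable_norm_mult_norm:
  fixes u :: "'w \<Rightarrow> 'h::{real_normed_vector, second_countable_topology}"
    and v :: "'w \<Rightarrow> 'k::{real_normed_vector, second_countable_topology}"
  assumes u: "square_integrable_rv P u" and v: "square_integrable_rv P v"
  shows "integrable P (\<lambda>\<omega>. norm (u \<omega>) * norm (v \<omega>))"
proof -
  note [measurable] = square_integrable_rv_measurable[OF u] square_integrable_rv_measurable[OF v]
  show ?thesis
  proof (rule Bochner_Integration.integrable_bound)
    show "integrable P (\<lambda>\<omega>. (norm (u \<omega>))\<^sup>2 + (norm (v \<omega>))\<^sup>2)"
      by (simp add: square_integrable_rv_integrable u v)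
    have "norm (u \<omega>) * norm (v \<omega>) \<le> (norm (u \<omega>))\<^sup>2 + (norm (v \<omega>))\<^sup>2" for \<omega>
    proof -
      have "0 \<le> norm (u \<omega>) * norm (v \<omega>)" by simp
      then show ?thesis
        using sum_squares_bound[of "norm (u \<omega>)" "norm (v \<omega>)"] by linarith
    qed
    then show "AE \<omega> in P. norm (norm (u \<omega>) * norm (v \<omega>)) \<le> norm ((norm (u \<omega>))\<^sup>2 + (norm (v \<omega>))\<^sup>2)"
      by auto
  qed simp
qed

text \<open>Cauchy-Schwarz in mean square. For nonzero norms \<open>a\<close> and \<open>b\<close>
  the weights \<open>b / (2 * a)\<close> and \<open>a / (2 * b)\<close> make the integrated Young
  inequality exactly \<open>a * b\<close>; if one norm is zero, its factor vanishes almost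
  everywhere.\<close>

lemma integral_norm_mult_norm_le:
  fixes u :: "'w \<Rightarrow> 'h::{real_normed_vector, second_countable_topology}"
    and v :: "'w \<Rightarrow> 'k::{real_normed_vector, second_countable_topology}"
  assumes u: "square_integrable_rv P u" and v: "square_integrable_rv P v"
  shows "(\<integral>\<omega>. norm (u \<omega>) * norm (v \<omega>) \<partial>P) \<le> L2_norm P u * L2_norm P v"
proof -
  note [measurable] = square_integrable_rv_measurable[OF u] square_integrable_rv_measurable[OF v]
  define a b where "a = L2_norm P u" and "b = L2_norm P v"
  have ab: "0 \<le> a" "0 \<le> b" by (simp_all add: a_def b_def)
  show ?thesis
  proof (cases "a = 0 \<or> b = 0")
    case True
    then have "(AE \<omega> in P. norm (u \<omega>) = 0) \<or> (AE \<omega> in P. norm (v \<omega>) = 0)"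
      using integral_nonneg_eq_0_iff_AE[OF square_integrable_rv_integrable[OF u]]
        integral_nonneg_eq_0_iff_AE[OF square_integrable_rv_integrable[OF v]]
      by (auto simp: a_def b_def L2_norm_def)
    then have "AE \<omega> in P. norm (u \<omega>) * norm (v \<omega>) = 0" by auto
    then have "(\<integral>\<omega>. norm (u \<omega>) * norm (v \<omega>) \<partial>P) = (\<integral>\<omega>. 0 \<partial>P)"
      by (intro integral_cong_AE) auto
    then show ?thesis by simp
  next
    case False
    then have pos: "0 < a" "0 < b" using ab by auto
    have am: "norm (u \<omega>) * norm (v \<omega>) \<le> b / (2 * a) * (norm (u \<omega>))\<^sup>2 + a / (2 * b) * (norm (v \<omega>))\<^sup>2" for \<omega>
    proof -
      have "0 \<le> (b * norm (u \<omega>) - a * norm (v \<omega>))\<^sup>2 / (2 * a * b)"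
        using pos by simp
      also have "\<dots> = b / (2 * a) * (norm (u \<omega>))\<^sup>2 + a / (2 * b) * (norm (v \<omega>))\<^sup>2 - norm (u \<omega>) * norm (v \<omega>)"
        using pos by (simp add: field_simps power2_eq_square)
      finally show ?thesis by simp
    qed
    have "(\<integral>\<omega>. norm (u \<omega>) * norm (v \<omega>) \<partial>P) \<le>
        (\<integral>\<omega>. b / (2 * a) * (norm (u \<omega>))\<^sup>2 + a / (2 * b) * (norm (v \<omega>))\<^sup>2 \<partial>P)"
      by (intro integral_mono am integrable_norm_mult_norm[OF u v] Bochner_Integration.integrable_add
          integrable_mult_right square_integrable_rv_integrable[OF u]
          square_integrable_rv_integrable[OF v])
    also have "\<dots> = b / (2 * a) * a\<^sup>2 + a / (2 * b) * b\<^sup>2"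
      by (simp add: square_integrable_rv_integrable u v a_def b_def L2_norm_sq)
    also have "\<dots> = a * b"
      using pos by (simp add: power2_eq_square)
    finally show ?thesis by (simp add: a_def b_def)
  qed
qed

lemma L2_norm_triangle:
  fixes u v :: "'w \<Rightarrow> 'h::{real_normed_vector, second_countable_topology}"
  assumes u: "square_integrable_rv P u" and v: "square_integrable_rv P v"
  shows "L2_norm P (\<lambda>\<omega>. u \<omega> + v \<omega>) \<le> L2_norm P u + L2_norm P v"
proof (rule power2_le_imp_le)
  note int = square_integrable_rv_integrable[OF u] square_integrable_rv_integrable[OF v]
    integrable_norm_mult_norm[OF u v]
  have "(norm (u \<omega> + v \<omega>))\<^sup>2 \<le> (norm (u \<omega>))\<^sup>2 + (norm (v \<omega>))\<^sup>2 + 2 * (norm (u \<omega>) * norm (v \<omega>))" for \<omega>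
    using power_mono[OF norm_triangle_ineq[of "u \<omega>" "v \<omega>"], of 2] by (simp add: power2_sum)
  then have "(L2_norm P (\<lambda>\<omega>. u \<omega> + v \<omega>))\<^sup>2 \<le>
      (\<integral>\<omega>. (norm (u \<omega>))\<^sup>2 + (norm (v \<omega>))\<^sup>2 + 2 * (norm (u \<omega>) * norm (v \<omega>)) \<partial>P)"
    unfolding L2_norm_sq
    using int square_integrable_rv_integrable[OF square_integrable_rv_add[OF u v]]
    by (intro integral_mono) auto
  also have "\<dots> = (L2_norm P u)\<^sup>2 + (L2_norm P v)\<^sup>2 + 2 * (\<integral>\<omega>. norm (u \<omega>) * norm (v \<omega>) \<partial>P)"
    using int by (simp add: L2_norm_sq)
  also have "\<dots> \<le> (L2_norm P u + L2_norm P v)\<^sup>2"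
    using integral_norm_mult_norm_le[OF u v] by (simp add: power2_sum)
  finally show "(L2_norm P (\<lambda>\<omega>. u \<omega> + v \<omega>))\<^sup>2 \<le> (L2_norm P u + L2_norm P v)\<^sup>2" .
qed simp

lemma L2_norm_scaleR: "L2_norm P (\<lambda>\<omega>. c *\<^sub>R u \<omega>) = \<bar>c\<bar> * L2_norm P u"
  by (simp add: L2_norm_def power_mult_distrib real_sqrt_mult)

lemma L2_norm_minus_commute: "L2_norm P (\<lambda>\<omega>. u \<omega> - v \<omega>) = L2_norm P (\<lambda>\<omega>. v \<omega> - u \<omega>)"
  by (simp add: L2_norm_def norm_minus_commute)

lemma L2_norm_sum:
  fixes u :: "'i \<Rightarrow> 'w \<Rightarrow> 'h::{real_normed_vector, second_countable_topology}"
  assumes "\<And>i. i \<in> A \<Longrightarrow> square_integrable_rv P (u i)"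
  shows "L2_norm P (\<lambda>\<omega>. \<Sum>i\<in>A. u i \<omega>) \<le> (\<Sum>i\<in>A. L2_norm P (u i))"
  using assms
proof (induction A rule: infinite_finite_induct)
  case (insert x A)
  have "L2_norm P (\<lambda>\<omega>. u x \<omega> + (\<Sum>i\<in>A. u i \<omega>)) \<le> L2_norm P (u x) + L2_norm P (\<lambda>\<omega>. \<Sum>i\<in>A. u i \<omega>)"
    using insert by (intro L2_norm_triangle square_integrable_rv_sum) auto
  then show ?case using insert by simp
qed auto

section \<open>Inner products and orthogonality in mean square\<close>

lemma integrable_inner_square_integrable:
  fixes u v :: "'w \<Rightarrow> 'h::{real_inner, second_countable_topology}"
  assumes u: "square_integrable_rv P u" and v: "square_integrable_rv P v"
  shows "integrable P (\<lambda>\<omega>. u \<omega> \<bullet> v \<omega>)"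
proof -
  note [measurable] = square_integrable_rv_measurable[OF u] square_integrable_rv_measurable[OF v]
  show ?thesis
    by (rule Bochner_Integration.integrable_bound[OF integrable_norm_mult_norm[OF u v]])
      (auto simp: Cauchy_Schwarz_ineq2)
qed

lemma abs_integral_inner_le:
  fixes u v :: "'w \<Rightarrow> 'h::{real_inner, second_countable_topology}"
  assumes u: "square_integrable_rv P u" and v: "square_integrable_rv P v"
  shows "\<bar>\<integral>\<omega>. u \<omega> \<bullet> v \<omega> \<partial>P\<bar> \<le> L2_norm P u * L2_norm P v"
proof -
  have "\<bar>\<integral>\<omega>. u \<omega> \<bullet> v \<omega> \<partial>P\<bar> \<le> (\<integral>\<omega>. \<bar>u \<omega> \<bullet> v \<omega>\<bar> \<partial>P)"
    by (rule integral_abs_bound)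
  also have "\<dots> \<le> (\<integral>\<omega>. norm (u \<omega>) * norm (v \<omega>) \<partial>P)"
    by (intro integral_mono integrable_norm_mult_norm u v integrable_abs
        integrable_inner_square_integrable Cauchy_Schwarz_ineq2)
  also have "\<dots> \<le> L2_norm P u * L2_norm P v" by (rule integral_norm_mult_norm_le[OF u v])
  finally show ?thesis .
qed

text \<open>Pythagoras in mean square. It is applied twice: to the modes of the noise within one
  step, and to the noise of the successive fine steps.\<close>

lemma L2_norm_sum_orthogonal:
  fixes u :: "'i \<Rightarrow> 'w \<Rightarrow> 'h::{real_inner, second_countable_topology}"
  assumes "finite A" and sq: "\<And>i. i \<in> A \<Longrightarrow> square_integrable_rv P (u i)"
    and orth: "\<And>i j. i \<in> A \<Longrightarrow> j \<in> A \<Longrightarrow> i \<noteq> j \<Longrightarrow> (\<integral>\<omega>. u i \<omega> \<bullet> u j \<omega> \<partial>P) = 0"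
  shows "(L2_norm P (\<lambda>\<omega>. \<Sum>i\<in>A. u i \<omega>))\<^sup>2 = (\<Sum>i\<in>A. (L2_norm P (u i))\<^sup>2)"
proof -
  have "(L2_norm P (\<lambda>\<omega>. \<Sum>i\<in>A. u i \<omega>))\<^sup>2 = (\<integral>\<omega>. (\<Sum>i\<in>A. \<Sum>j\<in>A. u i \<omega> \<bullet> u j \<omega>) \<partial>P)"
    unfolding L2_norm_sq power2_norm_eq_inner inner_sum_left inner_sum_right
    by (simp add: inner_commute)
  also have "\<dots> = (\<Sum>i\<in>A. \<Sum>j\<in>A. \<integral>\<omega>. u i \<omega> \<bullet> u j \<omega> \<partial>P)"
    by (simp add: integrable_inner_square_integrable sq)
  also have "\<dots> = (\<Sum>i\<in>A. \<Sum>j\<in>A. if j = i then \<integral>\<omega>. u i \<omega> \<bullet> u i \<omega> \<partial>P else 0)"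
    by (intro sum.cong refl) (auto simp: orth)
  also have "\<dots> = (\<Sum>i\<in>A. (L2_norm P (u i))\<^sup>2)"
    using \<open>finite A\<close> by (simp add: L2_norm_sq power2_norm_eq_inner)
  finally show ?thesis .
qed

lemma (in prob_space) integral_norm_le_L2_norm:
  fixes u :: "'a \<Rightarrow> 'h::{real_normed_vector, second_countable_topology}"
  assumes "square_integrable_rv M u"
  shows "(\<integral>\<omega>. norm (u \<omega>) \<partial>M) \<le> L2_norm M u"
  using integral_norm_mult_norm_le[OF assms, of "\<lambda>_. 1::real"]
  by (simp add: square_integrable_rv_def L2_norm_def prob_space)

lemma (in prob_space) square_integrable_rv_imp_integrable:
  fixes u :: "'a \<Rightarrow> 'h::{banach, second_countable_topology}"
  assumes "square_integrable_rv M u"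
  shows "integrable M u"
  using integrable_norm_mult_norm[OF assms, of "\<lambda>_. 1::real"] assms
  by (simp add: square_integrable_rv_def integrable_norm_iff)

text \<open>The limit is taken in a sub-sigma-algebra because the noise increments have to be adapted.\<close>

lemma (in prob_space) L2_Cauchy_limit:
  fixes X :: "nat \<Rightarrow> 'a \<Rightarrow> 'h::{banach, second_countable_topology}"
  assumes sub: "subalgebra M G" and meas: "\<And>n. X n \<in> borel_measurable G"
    and sq: "\<And>n. square_integrable_rv M (X n)"
    and Cauchy: "\<And>\<epsilon>. 0 < \<epsilon> \<Longrightarrow> \<exists>N. \<forall>i\<ge>N. \<forall>j\<ge>N. L2_norm M (\<lambda>\<omega>. X i \<omega> - X j \<omega>) < \<epsilon>"
  shows "\<exists>Y. Y \<in> borel_measurable G \<and>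
    (\<lambda>n. \<integral>\<^sup>+\<omega>. ennreal ((norm (Y \<omega> - X n \<omega>))\<^sup>2) \<partial>M) \<longlonglongrightarrow> 0"
proof -
  have [measurable]: "X n \<in> borel_measurable M" for n
    using sq by (rule square_integrable_rv_measurable)
  \<comment> \<open>An almost surely convergent subsequence is extracted from a Cauchy sequence in
    \<open>L\<^sup>1\<close>; on a probability space the mean-square norm dominates that
    norm.\<close>
  have "\<exists>N. \<forall>i\<ge>N. \<forall>j\<ge>N. (\<integral>\<omega>. norm (X i \<omega> - X j \<omega>) \<partial>M) < \<epsilon>" if "0 < \<epsilon>" for \<epsilon>
    using Cauchy[OF that] integral_norm_le_L2_norm[OF square_integrable_rv_diff[OF sq sq]]
    by (meson order_le_less_trans)
  then obtain r where r: "strict_mono r" "AE \<omega> in M. Cauchy (\<lambda>i. X (r i) \<omega>)"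
    by (rule cauchy_L1_AE_cauchy_subseq[OF square_integrable_rv_imp_integrable[OF sq]]) auto
  \<comment> \<open>\<open>lim\<close> is total, with one fixed value on divergent sequences. Hence
    \<open>Y\<close> is measurable in \<open>G\<close> as it stands, without a correction on a null
    set that might not belong to \<open>G\<close>.\<close>
  define Y where "Y \<omega> = lim (\<lambda>i. X (r i) \<omega>)" for \<omega>
  have YG: "Y \<in> borel_measurable G"
    unfolding Y_def using meas by (intro borel_measurable_lim_metric) auto
  then have [measurable]: "Y \<in> borel_measurable M"
    by (rule measurable_from_subalg[OF sub])
  have conv: "AE \<omega> in M. (\<lambda>i. X (r i) \<omega>) \<longlonglongrightarrow> Y \<omega>"
    using r(2) unfolding Y_def by (auto simp: Cauchy_convergent_iff convergent_LIMSEQ_iff)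
  have bound: "\<exists>N. \<forall>n\<ge>N. (\<integral>\<^sup>+\<omega>. ennreal ((norm (Y \<omega> - X n \<omega>))\<^sup>2) \<partial>M) \<le> ennreal \<epsilon>"
    if "0 < \<epsilon>" for \<epsilon>
  proof -
    obtain N where N: "\<And>i j. i \<ge> N \<Longrightarrow> j \<ge> N \<Longrightarrow> L2_norm M (\<lambda>\<omega>. X i \<omega> - X j \<omega>) < sqrt \<epsilon>"
      using Cauchy[of "sqrt \<epsilon>"] real_sqrt_gt_zero[OF \<open>0 < \<epsilon>\<close>] by blast
    have "(\<integral>\<^sup>+\<omega>. ennreal ((norm (Y \<omega> - X n \<omega>))\<^sup>2) \<partial>M) \<le> ennreal \<epsilon>" if n: "n \<ge> N" for n
    proof -
      have "(\<integral>\<^sup>+\<omega>. ennreal ((norm (Y \<omega> - X n \<omega>))\<^sup>2) \<partial>M) =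
          (\<integral>\<^sup>+\<omega>. liminf (\<lambda>i. ennreal ((norm (X (r i) \<omega> - X n \<omega>))\<^sup>2)) \<partial>M)"
      proof (rule nn_integral_cong_AE)
        show "AE \<omega> in M. ennreal ((norm (Y \<omega> - X n \<omega>))\<^sup>2) =
            liminf (\<lambda>i. ennreal ((norm (X (r i) \<omega> - X n \<omega>))\<^sup>2))"
          using conv
        proof eventually_elim
          case (elim \<omega>)
          have "(\<lambda>i. ennreal ((norm (X (r i) \<omega> - X n \<omega>))\<^sup>2)) \<longlonglongrightarrow> ennreal ((norm (Y \<omega> - X n \<omega>))\<^sup>2)"
            using elim by (intro tendsto_ennrealI tendsto_intros) auto
          then show ?case by (rule lim_imp_Liminf[OF sequentially_bot, symmetric])
        qed
      qed
      \<comment> \<open>Fatou's lemma carries the Cauchy bound between \<open>X (r i)\<close> and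
        \<open>X n\<close> over to the limit \<open>Y\<close>.\<close>
      also have "\<dots> \<le> liminf (\<lambda>i. \<integral>\<^sup>+\<omega>. ennreal ((norm (X (r i) \<omega> - X n \<omega>))\<^sup>2) \<partial>M)"
        by (rule nn_integral_liminf) measurable
      also have "\<dots> \<le> liminf (\<lambda>i. ennreal \<epsilon>)"
      proof (rule Liminf_mono, rule eventually_sequentiallyI[of N])
        fix i assume "i \<ge> N"
        then have "r i \<ge> N" using seq_suble[OF r(1), of i] by linarith
        then have "(L2_norm M (\<lambda>\<omega>. X (r i) \<omega> - X n \<omega>))\<^sup>2 \<le> (sqrt \<epsilon>)\<^sup>2"
          using N[of "r i" n] n by (intro power_mono) auto
        then show "(\<integral>\<^sup>+\<omega>. ennreal ((norm (X (r i) \<omega> - X n \<omega>))\<^sup>2) \<partial>M) \<le> ennreal \<epsilon>"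
          using \<open>0 < \<epsilon>\<close> by (simp add: nn_integral_norm_sq square_integrable_rv_diff sq ennreal_leI)
      qed
      finally show ?thesis by (simp add: Liminf_const)
    qed
    then show ?thesis by blast
  qed
  have "(\<lambda>n. \<integral>\<^sup>+\<omega>. ennreal ((norm (Y \<omega> - X n \<omega>))\<^sup>2) \<partial>M) \<longlonglongrightarrow> 0"
  proof (rule order_tendstoI)
    fix y :: ennreal assume "0 < y"
    have "\<exists>\<epsilon>>0. ennreal \<epsilon> < y"
    proof (cases y)
      case (real r)
      then show ?thesis using \<open>0 < y\<close> by (intro exI[of _ "r / 2"]) (auto simp: ennreal_less_iff)
    next
      case top
      then show ?thesis by (intro exI[of _ 1]) auto
    qed
    then obtain \<epsilon> where "0 < \<epsilon>" "ennreal \<epsilon> < y" by blast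
    then show "\<forall>\<^sub>F n in sequentially. (\<integral>\<^sup>+\<omega>. ennreal ((norm (Y \<omega> - X n \<omega>))\<^sup>2) \<partial>M) < y"
      using bound[of \<epsilon>] unfolding eventually_sequentially by (meson order_le_less_trans)
  qed simp
  with YG show ?thesis by blast
qed

section \<open>Strongly continuous semigroups\<close>

text \<open>Uniform boundedness by Baire's theorem. The index of \<open>A n\<close> serves as the
  bound and, inverted, as the length of the time interval, so countably many closed sets suffice;
  strong continuity at 0 makes them cover the space. One of them then contains a ball.\<close>

lemma C0_semigroup_bounded_near_0:
  fixes S :: "real \<Rightarrow> 'h \<Rightarrow> 'h::banach"
  assumes S: "C0_semigroup S"
  obtains \<delta> K where "0 < \<delta>" "1 \<le> K" "\<And>t x. 0 \<le> t \<Longrightarrow> t \<le> \<delta> \<Longrightarrow> norm (S t x) \<le> K * norm x"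
proof -
  have lin: "bounded_linear (S t)" if "0 \<le> t" for t
    using S that by (simp add: C0_semigroup_def)
  define A where "A n = {x. \<forall>t. 0 < t \<and> t \<le> 1 / real (Suc n) \<longrightarrow> norm (S t x) \<le> real (Suc n)}" for n
  have closed: "closed (A n)" for n
  proof -
    have "A n = (\<Inter>t\<in>{0<..1 / real (Suc n)}. {x. norm (S t x) \<le> real (Suc n)})"
      by (auto simp: A_def)
    moreover have "closed {x. norm (S t x) \<le> real (Suc n)}" if "0 < t" for t
      using lin[of t] that
      by (intro closed_Collect_le continuous_intros linear_continuous_on) auto
    ultimately show ?thesis by (simp add: closed_INT)
  qed
  have "\<exists>n. x \<in> A n" for x
  proof -
    have "((\<lambda>t. norm (S t x)) \<longlongrightarrow> norm x) (at_right 0)"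
      using S by (intro tendsto_norm) (simp add: C0_semigroup_def)
    then have "\<forall>\<^sub>F t in at_right 0. norm (S t x) < norm x + 1"
      by (rule order_tendstoD) simp
    then obtain d where d: "0 < d" "\<And>t. 0 < t \<Longrightarrow> t < d \<Longrightarrow> norm (S t x) < norm x + 1"
      by (auto simp: eventually_at_right_field)
    obtain n where n: "max (norm x + 1) (1 / d) < real n" using reals_Archimedean2 by blast
    then have "1 / d < real (Suc n)" by simp
    then have "1 / real (Suc n) < d"
      using d(1) by (simp add: divide_less_eq mult.commute)
    then have "x \<in> A n" using d n by (fastforce simp: A_def)
    then show ?thesis ..
  qed
  then have cover: "(\<Union>n. A n) = UNIV" by blast
  have "\<exists>n. interior (A n) \<noteq> {}"
  proof (rule ccontr)
    assume "\<not> ?thesis"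
    then have "Met_TC.mtopology interior_of (\<Union>(range A)) = {}"
      using closed
      by (intro Met_TC.metric_Baire_category_alt) (auto simp: complete_UNIV)
    then show False using cover by simp
  qed
  then obtain n x0 r where r: "0 < r" "cball x0 r \<subseteq> A n"
    unfolding ex_in_conv[symmetric] mem_interior_cball by blast
  show thesis
  proof (rule that)
    \<comment> \<open>A vector \<open>y\<close> of length \<open>r\<close> is the difference of
      \<open>x0 + y\<close> and \<open>x0\<close>, both in the ball, hence the bound
      \<open>2 * real (Suc n)\<close>, scaled by \<open>1 / r\<close>. The value 1 takes care of
      \<open>t = 0\<close>.\<close>
    define K where "K = max 1 (2 * real (Suc n) / r)"
    show "1 \<le> K" by (simp add: K_def)
    show "0 < 1 / real (Suc n)" by simp
    show "norm (S t x) \<le> K * norm x" if t: "0 \<le> t" "t \<le> 1 / real (Suc n)" for t x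
    proof (cases "t = 0 \<or> x = 0")
      case True
      have "1 * norm x \<le> K * norm x" by (intro mult_right_mono) (auto simp: K_def)
      then show ?thesis
        using True S lin[OF t(1)] by (auto simp: C0_semigroup_def linear_simps)
    next
      case False
      define y where "y = (r / norm x) *\<^sub>R x"
      interpret St: bounded_linear "S t" by (rule lin[OF t(1)])
      have "x0 + y \<in> A n" "x0 \<in> A n" using r False by (auto simp: y_def dist_norm intro!: subsetD[OF r(2)])
      then have "norm (S t (x0 + y)) \<le> real (Suc n)" "norm (S t x0) \<le> real (Suc n)"
        using t False by (auto simp: A_def)
      then have "norm (S t y) \<le> 2 * real (Suc n)"
        using norm_triangle_ineq4[of "S t (x0 + y)" "S t x0"] by (simp add: St.add)
      then have "(r / norm x) * norm (S t x) \<le> 2 * real (Suc n)"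
        using r(1) by (simp add: y_def St.scaleR)
      then have "norm (S t x) \<le> 2 * real (Suc n) / r * norm x"
        using r(1) False by (simp add: field_simps)
      also have "\<dots> \<le> K * norm x" by (intro mult_right_mono) (auto simp: K_def)
      finally show ?thesis .
    qed
  qed
qed

text \<open>Finitely many pieces of length \<open>\<delta>\<close> cover the interval up to
  \<open>T\<close>, and by the semigroup law each piece costs at most one factor \<open>K\<close>.
  Since \<open>1 \<le> K\<close>, the largest power bounds all of them.\<close>

lemma C0_semigroup_bounded:
  fixes S :: "real \<Rightarrow> 'h \<Rightarrow> 'h::banach"
  assumes S: "C0_semigroup S"
  obtains K where "1 \<le> K" "\<And>t x. 0 \<le> t \<Longrightarrow> t \<le> T \<Longrightarrow> norm (S t x) \<le> K * norm x"
proof -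
  obtain \<delta> K where \<delta>: "0 < \<delta>" and K: "1 \<le> K"
    and b: "\<And>t x. 0 \<le> t \<Longrightarrow> t \<le> \<delta> \<Longrightarrow> norm (S t x) \<le> K * norm x"
    using C0_semigroup_bounded_near_0[OF S] by blast
  have n: "norm (S t x) \<le> K ^ Suc n * norm x" if "0 \<le> t" "t \<le> real (Suc n) * \<delta>" for n t x
    using that
  proof (induction n arbitrary: t x)
    case 0
    then show ?case using b by simp
  next
    case (Suc n)
    show ?case
    proof (cases "t \<le> \<delta>")
      case True
      have "norm (S t x) \<le> K * norm x" using b Suc.prems True by simp
      also have "\<dots> \<le> K ^ Suc (Suc n) * norm x"
        using K power_increasing[of 1 "Suc (Suc n)" K] by (intro mult_right_mono) auto
      finally show ?thesis .
    next
      case False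
      have "S t x = S \<delta> (S (t - \<delta>) x)"
      proof -
        have "0 \<le> \<delta>" "0 \<le> t - \<delta>" using False \<delta> by auto
        then have "S (\<delta> + (t - \<delta>)) x = S \<delta> (S (t - \<delta>) x)"
          using S unfolding C0_semigroup_def by blast
        then show ?thesis by simp
      qed
      also have "norm \<dots> \<le> K * norm (S (t - \<delta>) x)" using b \<delta> by simp
      also have "\<dots> \<le> K * (K ^ Suc n * norm x)"
        using Suc.IH[of "t - \<delta>" x] Suc.prems False K by (intro mult_left_mono) (auto simp: algebra_simps)
      finally show ?thesis by simp
    qed
  qed
  obtain m where "T / \<delta> < real m" using reals_Archimedean2 by blast
  then have "T \<le> real (Suc m) * \<delta>" using \<delta> by (simp add: field_simps)
  then show thesis
    using that[of "K ^ Suc m"] n K by (meson one_le_power order_trans)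
qed

section \<open>Operators on the range of the square root of the covariance\<close>

text \<open>For complete orthonormal \<open>e\<close> the vectors \<open>sqrt_op e lam (e n)\<close>
  with \<open>0 < lam n\<close> are an orthonormal basis of \<open>U0\<close>, so the squared norms
  of these images sum to the squared Hilbert-Schmidt norm on \<open>U0\<close>. Evaluating there
  keeps \<open>\<Phi>\<close> on the space where it is linear.\<close>

definition sqrt_coef :: "(nat \<Rightarrow> 'h::real_inner) \<Rightarrow> (nat \<Rightarrow> real) \<Rightarrow> ('h \<Rightarrow> 'h) \<Rightarrow> nat \<Rightarrow> 'h" where
  "sqrt_coef e lam \<Phi> n = \<Phi> (sqrt_op e lam (e n))"

text \<open>Coordinate with respect to \<open>sqrt (lam n) *\<^sub>R e n\<close>: on an increment of
  \<open>W\<close> it is almost surely the increment of \<open>\<beta> n\<close>. Modes with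
  \<open>lam n = 0\<close> carry no noise and get the value 0.\<close>

definition normalized_coord :: "(nat \<Rightarrow> 'h::real_inner) \<Rightarrow> (nat \<Rightarrow> real) \<Rightarrow> nat \<Rightarrow> 'h \<Rightarrow> real" where
  "normalized_coord e lam n x = (if 0 < lam n then (x \<bullet> e n) / sqrt (lam n) else 0)"

lemma hs0_norm_eq: "hs0_norm e lam \<Phi> = sqrt (\<Sum>n. (norm (sqrt_coef e lam \<Phi> n))\<^sup>2)"
  by (simp add: hs0_norm_def hs_norm_def sqrt_coef_def)

lemma summable_sqrt_coef:
  "\<Phi> \<in> HS0 e lam \<Longrightarrow> summable (\<lambda>n. (norm (sqrt_coef e lam \<Phi> n))\<^sup>2)"
  by (simp add: HS0_def hilbert_schmidt_def sqrt_coef_def)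

lemma sum_sqrt_coef_le:
  assumes "summable (\<lambda>n. (norm (sqrt_coef e lam \<Phi> n))\<^sup>2)" "finite A"
  shows "(\<Sum>n\<in>A. (norm (sqrt_coef e lam \<Phi> n))\<^sup>2) \<le> (hs0_norm e lam \<Phi>)\<^sup>2"
proof -
  have "0 \<le> (\<Sum>n. (norm (sqrt_coef e lam \<Phi> n))\<^sup>2)" by (intro suminf_nonneg assms) auto
  then show ?thesis
    unfolding hs0_norm_eq using sum_le_suminf[OF assms] by simp
qed

lemma hs0_norm_nonneg:
  "summable (\<lambda>n. (norm (sqrt_coef e lam \<Phi> n))\<^sup>2) \<Longrightarrow> 0 \<le> hs0_norm e lam \<Phi>"
  by (simp add: hs0_norm_eq suminf_nonneg)

lemma sqrt_coef_diff:
  "sqrt_coef e lam (\<lambda>x. \<Phi> x - \<Psi> x) n = sqrt_coef e lam \<Phi> n - sqrt_coef e lam \<Psi> n"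
  by (simp add: sqrt_coef_def)

text \<open>The Lipschitz part of (A3) bounds \<open>hs0_norm\<close> of a difference. Being defined
  through \<open>suminf\<close>, that number controls partial sums only once the series is known to
  converge.\<close>

lemma summable_sqrt_coef_diff:
  assumes "\<Phi> \<in> HS0 e lam" "\<Psi> \<in> HS0 e lam"
  shows "summable (\<lambda>n. (norm (sqrt_coef e lam (\<lambda>x. \<Phi> x - \<Psi> x) n))\<^sup>2)"
proof (rule summable_comparison_test'[where N=0])
  show "summable (\<lambda>n. 2 * (norm (sqrt_coef e lam \<Phi> n))\<^sup>2 + 2 * (norm (sqrt_coef e lam \<Psi> n))\<^sup>2)"
    by (intro summable_add summable_mult summable_sqrt_coef assms)
qed (use norm_add_sq_le[of "sqrt_coef e lam \<Phi> _" "- sqrt_coef e lam \<Psi> _"] in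
    \<open>auto simp: sqrt_coef_diff\<close>)

context
  fixes e :: "nat \<Rightarrow> 'h::real_inner" and lam :: "nat \<Rightarrow> real"
  assumes orthonormal: "\<And>m n. e m \<bullet> e n = (if m = n then 1 else 0)"
    and lam_nonneg: "\<And>n. 0 \<le> lam n"
begin

lemma sqrt_op_sum:
  assumes "finite A"
  shows "sqrt_op e lam (\<Sum>n\<in>A. c n *\<^sub>R e n) = (\<Sum>n\<in>A. (sqrt (lam n) * c n) *\<^sub>R e n)"
proof -
  have inner: "(\<Sum>n\<in>A. c n *\<^sub>R e n) \<bullet> e k = (if k \<in> A then c k else 0)" for k
    using assms by (simp add: inner_sum_left orthonormal if_distrib[of "\<lambda>x. _ * x"] cong: if_cong)
  have "sqrt_op e lam (\<Sum>n\<in>A. c n *\<^sub>R e n) =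
      (\<Sum>k\<in>A. (sqrt (lam k) * (if k \<in> A then c k else 0)) *\<^sub>R e k)"
    unfolding sqrt_op_def inner using assms by (intro suminf_finite) auto
  then show ?thesis by (simp cong: sum.cong)
qed

text \<open>Members of \<open>HS0\<close> are linear on \<open>U0\<close> and arbitrary elsewhere.
  Dividing each coefficient by \<open>sqrt (lam n)\<close> exhibits a preimage, so such sums are
  admissible arguments.\<close>

lemma sum_in_U0:
  assumes "finite A" "\<And>n. n \<in> A \<Longrightarrow> 0 < lam n"
  shows "(\<Sum>n\<in>A. c n *\<^sub>R e n) \<in> U0 e lam"
proof -
  have "sqrt_op e lam (\<Sum>n\<in>A. (c n / sqrt (lam n)) *\<^sub>R e n) = (\<Sum>n\<in>A. c n *\<^sub>R e n)"
    using assms by (subst sqrt_op_sum) (auto intro!: sum.cong dest!: assms(2))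
  then show ?thesis unfolding U0_def by (metis rangeI)
qed

lemma HS0_sum:
  assumes \<Phi>: "\<Phi> \<in> HS0 e lam" and "finite A" "\<And>n. n \<in> A \<Longrightarrow> 0 < lam n"
  shows "\<Phi> (\<Sum>n\<in>A. c n *\<^sub>R e n) = (\<Sum>n\<in>A. c n *\<^sub>R \<Phi> (e n))"
  using assms(2,3)
proof (induction A)
  case empty
  have "0 \<in> U0 e lam" using sum_in_U0[of "{}"] by simp
  then have "\<Phi> (0 *\<^sub>R 0) = 0 *\<^sub>R \<Phi> 0" using \<Phi> unfolding HS0_def by blast
  then show ?case by simp
next
  case (insert k A)
  have U: "e k \<in> U0 e lam" "c k *\<^sub>R e k \<in> U0 e lam" "(\<Sum>n\<in>A. c n *\<^sub>R e n) \<in> U0 e lam"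
    using sum_in_U0[of "{k}" "\<lambda>_. 1"] sum_in_U0[of "{k}" c] sum_in_U0[of A c] insert by auto
  have "\<Phi> (c k *\<^sub>R e k + (\<Sum>n\<in>A. c n *\<^sub>R e n)) = \<Phi> (c k *\<^sub>R e k) + \<Phi> (\<Sum>n\<in>A. c n *\<^sub>R e n)"
    using \<Phi> U by (auto simp: HS0_def)
  moreover have "\<Phi> (c k *\<^sub>R e k) = c k *\<^sub>R \<Phi> (e k)"
    using \<Phi> U by (auto simp: HS0_def)
  ultimately show ?case using insert by simp
qed

lemma sqrt_coef_pos:
  assumes "\<Phi> \<in> HS0 e lam" "0 < lam n"
  shows "sqrt_coef e lam \<Phi> n = sqrt (lam n) *\<^sub>R \<Phi> (e n)"
  using sqrt_op_sum[of "{n}" "\<lambda>_. 1"] HS0_sum[OF assms(1), of "{n}" "\<lambda>_. sqrt (lam n)"] assms(2)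
  by (simp add: sqrt_coef_def)

text \<open>Separates the increment from the operator. With \<open>\<Phi> = B s (u \<omega>)\<close>
  the vectors are known at time \<open>s\<close>, while the scalar factors come from the increment
  after \<open>s\<close>. Modes with \<open>lam n = 0\<close> may be included, as their normalized
  coordinate is 0.\<close>

lemma HS0_U0_truncation:
  assumes \<Phi>: "\<Phi> \<in> HS0 e lam"
  shows "\<Phi> (U0_truncation e lam m x) = (\<Sum>n<m. normalized_coord e lam n x *\<^sub>R sqrt_coef e lam \<Phi> n)"
proof -
  have "\<Phi> (U0_truncation e lam m x) = (\<Sum>n | n < m \<and> 0 < lam n. (x \<bullet> e n) *\<^sub>R \<Phi> (e n))"
    unfolding U0_truncation_def by (rule HS0_sum[OF \<Phi>]) auto
  also have "\<dots> = (\<Sum>n | n < m \<and> 0 < lam n. normalized_coord e lam n x *\<^sub>R sqrt_coef e lam \<Phi> n)"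
    by (intro sum.cong) (auto simp: normalized_coord_def sqrt_coef_pos[OF \<Phi>])
  also have "\<dots> = (\<Sum>n<m. normalized_coord e lam n x *\<^sub>R sqrt_coef e lam \<Phi> n)"
    by (intro sum.mono_neutral_left) (auto simp: normalized_coord_def)
  finally show ?thesis .
qed

end

section \<open>Increments of the Wiener process\<close>

locale wiener_setting = prob_space P
  for P :: "'w measure" and T :: real and \<FF> :: "real \<Rightarrow> 'w measure"
    and e :: "nat \<Rightarrow> 'h::{real_inner, banach, second_countable_topology}" and lam :: "nat \<Rightarrow> real"
    and \<beta> :: "nat \<Rightarrow> real \<Rightarrow> 'w \<Rightarrow> real" and W :: "real \<Rightarrow> 'w \<Rightarrow> 'h" +
  assumes filtration: "filtration_on P T \<FF>"
    and orthonormal: "\<And>m n. e m \<bullet> e n = (if m = n then 1 else 0)"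
    and lam_nonneg: "\<And>n. 0 \<le> lam n"
    and wiener: "Q_wiener P T \<FF> e lam \<beta> W"
begin

lemma subalg: "0 \<le> t \<Longrightarrow> t \<le> T \<Longrightarrow> subalgebra P (\<FF> t)"
  using filtration by (simp add: filtration_on_def)

lemma measurable_later:
  assumes "f \<in> borel_measurable (\<FF> s)" "0 \<le> s" "s \<le> t" "t \<le> T"
  shows "f \<in> borel_measurable (\<FF> t)"
proof -
  have "subalgebra (\<FF> t) (\<FF> s)"
    using filtration assms subalg[of s] subalg[of t] by (auto simp: filtration_on_def subalgebra_def)
  then show ?thesis by (rule measurable_from_subalg) fact
qed

lemma measurable_P:
  "f \<in> borel_measurable (\<FF> s) \<Longrightarrow> 0 \<le> s \<Longrightarrow> s \<le> T \<Longrightarrow> f \<in> borel_measurable P"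
  using measurable_from_subalg[OF subalg] by blast

lemma W_measurable: "0 \<le> t \<Longrightarrow> t \<le> T \<Longrightarrow> W t \<in> borel_measurable (\<FF> t)"
  using wiener by (simp add: Q_wiener_def)

lemma beta_measurable: "0 \<le> t \<Longrightarrow> t \<le> T \<Longrightarrow> \<beta> n t \<in> borel_measurable P"
  using wiener by (simp add: Q_wiener_def standard_wiener_def)

text \<open>From \<open>n < m\<close> on, the coordinate along \<open>e n\<close> of the
  \<open>m\<close>-th partial sum is constant, so its mean-square distance to that of
  \<open>W t\<close> is bounded by errors tending to 0.\<close>

lemma W_coordinate:
  assumes t: "0 \<le> t" "t \<le> T"
  shows "AE \<omega> in P. W t \<omega> \<bullet> e n = sqrt (lam n) * \<beta> n t \<omega>"
proof -
  note [measurable] = measurable_P[OF W_measurable[OF t] t] beta_measurable[OF t]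
  define g where "g m \<omega> = W t \<omega> - (\<Sum>k<m. (sqrt (lam k) * \<beta> k t \<omega>) *\<^sub>R e k)" for m \<omega>
  have [measurable]: "g m \<in> borel_measurable P" for m by (simp add: g_def[abs_def])
  have lim: "(\<lambda>m. \<integral>\<^sup>+\<omega>. ennreal ((norm (g m \<omega>))\<^sup>2) \<partial>P) \<longlonglongrightarrow> 0"
    using wiener t by (simp add: Q_wiener_def g_def)
  have norm_e: "norm (e n) = 1" using orthonormal[of n n] by (simp add: norm_eq_1)
  have "(\<integral>\<^sup>+\<omega>. ennreal ((W t \<omega> \<bullet> e n - sqrt (lam n) * \<beta> n t \<omega>)\<^sup>2) \<partial>P) \<le>
      (\<integral>\<^sup>+\<omega>. ennreal ((norm (g m \<omega>))\<^sup>2) \<partial>P)" if "n < m" for m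
  proof (intro nn_integral_mono ennreal_leI)
    fix \<omega>
    have "g m \<omega> \<bullet> e n = W t \<omega> \<bullet> e n - sqrt (lam n) * \<beta> n t \<omega>"
      using that by (simp add: g_def inner_diff_left inner_sum_left orthonormal
          if_distrib[of "\<lambda>x. _ * x"] cong: if_cong)
    then have "\<bar>W t \<omega> \<bullet> e n - sqrt (lam n) * \<beta> n t \<omega>\<bar> \<le> norm (g m \<omega>)"
      using Cauchy_Schwarz_ineq2[of "g m \<omega>" "e n"] norm_e by simp
    then show "(W t \<omega> \<bullet> e n - sqrt (lam n) * \<beta> n t \<omega>)\<^sup>2 \<le> (norm (g m \<omega>))\<^sup>2"
      by (simp add: abs_le_square_iff[symmetric])
  qed
  then have "(\<integral>\<^sup>+\<omega>. ennreal ((W t \<omega> \<bullet> e n - sqrt (lam n) * \<beta> n t \<omega>)\<^sup>2) \<partial>P) \<le> 0"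
    by (intro LIMSEQ_le_const[OF lim]) (meson Suc_le_eq)
  then have "(\<integral>\<^sup>+\<omega>. ennreal ((W t \<omega> \<bullet> e n - sqrt (lam n) * \<beta> n t \<omega>)\<^sup>2) \<partial>P) = 0"
    by simp
  then have "AE \<omega> in P. ennreal ((W t \<omega> \<bullet> e n - sqrt (lam n) * \<beta> n t \<omega>)\<^sup>2) = 0"
    by (subst (asm) nn_integral_0_iff_AE) auto
  then show ?thesis by eventually_elim (simp add: ennreal_eq_0_iff)
qed

lemma increment_moments:
  fixes n :: nat
  assumes "0 \<le> s" "s < t" "t \<le> T"
  defines "b \<equiv> \<lambda>\<omega>. \<beta> n t \<omega> - \<beta> n s \<omega>"
  shows "integrable P b" "expectation b = 0"
    "integrable P (\<lambda>\<omega>. (b \<omega>)\<^sup>2)" "expectation (\<lambda>\<omega>. (b \<omega>)\<^sup>2) = t - s"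
proof -
  have "standard_wiener P T (\<beta> n)" using wiener by (simp add: Q_wiener_def)
  then have D: "distributed P lborel b (\<lambda>x. ennreal (normal_density 0 (sqrt (t - s)) x))"
    using assms by (simp add: standard_wiener_def)
  have pos: "0 < sqrt (t - s)" using assms by simp
  show "integrable P b"
    using integrable_normal_moment[OF pos, of 0 1] by (intro distributed_integrable_var[OF D]) auto
  show "expectation b = 0" by (rule normal_distributed_expectation[OF pos D])
  show "integrable P (\<lambda>\<omega>. (b \<omega>)\<^sup>2)"
    using integrable_normal_moment[OF pos, of 0 2] distributed_integrable[OF D, of "\<lambda>x. x\<^sup>2"] by simp
  show "expectation (\<lambda>\<omega>. (b \<omega>)\<^sup>2) = t - s"
    using normal_distributed_variance[OF pos D] \<open>expectation b = 0\<close> assms by simp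
qed

text \<open>Independence is assumed for whole paths as elements of a product space; an increment is
  a measurable function of its path and inherits it.\<close>

lemma increment_uncorrelated:
  assumes st: "0 \<le> s" "s < t" "t \<le> T" and "i \<noteq> j"
  shows "integrable P (\<lambda>\<omega>. (\<beta> i t \<omega> - \<beta> i s \<omega>) * (\<beta> j t \<omega> - \<beta> j s \<omega>))"
    "expectation (\<lambda>\<omega>. (\<beta> i t \<omega> - \<beta> i s \<omega>) * (\<beta> j t \<omega> - \<beta> j s \<omega>)) = 0"
proof -
  have "indep_vars (\<lambda>_. \<Pi>\<^sub>M r\<in>{0..T}. borel) (\<lambda>n \<omega>. \<lambda>r\<in>{0..T}. \<beta> n r \<omega>) UNIV"
    using wiener by (simp add: Q_wiener_def independent_processes_def)
  then have "indep_vars (\<lambda>_. borel) (\<lambda>n \<omega>. (\<lambda>f. f t - f s) (\<lambda>r\<in>{0..T}. \<beta> n r \<omega>)) UNIV"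
  proof (rule indep_vars_compose2)
    have [measurable]: "(\<lambda>f. f r) \<in> borel_measurable (\<Pi>\<^sub>M r\<in>{0..T}. (borel :: real measure))"
      if "r \<in> {0..T}" for r
      using that by (rule measurable_component_singleton)
    show "(\<lambda>f. f t - f s) \<in> borel_measurable (\<Pi>\<^sub>M r\<in>{0..T}. (borel :: real measure))"
      using st by (intro borel_measurable_diff) auto
  qed
  then have "indep_vars (\<lambda>_. borel) (\<lambda>n \<omega>. \<beta> n t \<omega> - \<beta> n s \<omega>) UNIV"
    using st by simp
  then have ind: "indep_vars (\<lambda>_. borel) (\<lambda>n \<omega>. \<beta> n t \<omega> - \<beta> n s \<omega>) {i, j}"
    by (rule indep_vars_subset) simp
  note moments = increment_moments(1,2)[OF st]
  show "integrable P (\<lambda>\<omega>. (\<beta> i t \<omega> - \<beta> i s \<omega>) * (\<beta> j t \<omega> - \<beta> j s \<omega>))"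
    using indep_vars_integrable[OF _ ind] moments \<open>i \<noteq> j\<close> by simp
  show "expectation (\<lambda>\<omega>. (\<beta> i t \<omega> - \<beta> i s \<omega>) * (\<beta> j t \<omega> - \<beta> j s \<omega>)) = 0"
    using indep_vars_lebesgue_integral[OF _ ind] moments \<open>i \<noteq> j\<close> by simp
qed

text \<open>Read off \<open>W\<close> and not defined by \<open>\<beta> n\<close>, because
  adaptedness and independence of the past are given for \<open>W\<close>. The Gaussian moments are
  transferred from \<open>\<beta> n\<close> through the almost sure identity
  \<open>noise_coord_AE\<close>.\<close>

abbreviation noise_coord :: "real \<Rightarrow> real \<Rightarrow> nat \<Rightarrow> 'w \<Rightarrow> real" where
  "noise_coord s t n \<equiv> \<lambda>\<omega>. normalized_coord e lam n (W t \<omega> - W s \<omega>)"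

lemma noise_coord_AE:
  assumes "0 \<le> s" "s \<le> T" "0 \<le> t" "t \<le> T" "0 < lam n"
  shows "AE \<omega> in P. noise_coord s t n \<omega> = \<beta> n t \<omega> - \<beta> n s \<omega>"
  using W_coordinate[OF assms(1,2), of n] W_coordinate[OF assms(3,4), of n]
  by eventually_elim (use \<open>0 < lam n\<close> in \<open>simp add: normalized_coord_def inner_diff_left field_simps\<close>)

lemma normalized_coord_measurable[measurable]:
  "normalized_coord e lam n \<in> borel_measurable borel"
  unfolding normalized_coord_def[abs_def] by simp

lemma noise_coord_measurable:
  assumes "0 \<le> s" "s \<le> t" "t \<le> T"
  shows "noise_coord s t n \<in> borel_measurable (\<FF> t)"
proof -
  have [measurable]: "W t \<in> borel_measurable (\<FF> t)" "W s \<in> borel_measurable (\<FF> t)"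
    using assms by (auto intro: W_measurable measurable_later[OF W_measurable])
  show ?thesis by measurable
qed

lemma noise_coord_mean:
  assumes st: "0 \<le> s" "s < t" "t \<le> T"
  shows "integrable P (noise_coord s t n) \<and> expectation (noise_coord s t n) = 0"
proof (cases "0 < lam n")
  case True
  have [measurable]: "noise_coord s t n \<in> borel_measurable P"
    using st by (intro measurable_P[OF noise_coord_measurable]) auto
  have [measurable]: "\<beta> n t \<in> borel_measurable P" "\<beta> n s \<in> borel_measurable P"
    using st by (auto intro: beta_measurable)
  have AE: "AE \<omega> in P. noise_coord s t n \<omega> = \<beta> n t \<omega> - \<beta> n s \<omega>"
    using st True by (intro noise_coord_AE) auto
  show ?thesis
    using increment_moments(1,2)[OF st, of n] integrable_cong_AE[OF _ _ AE] integral_cong_AE[OF _ _ AE]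
    by simp
qed (simp add: normalized_coord_def)

lemma noise_coord_covariance:
  assumes st: "0 \<le> s" "s < t" "t \<le> T"
  shows "integrable P (\<lambda>\<omega>. noise_coord s t i \<omega> * noise_coord s t j \<omega>) \<and>
    expectation (\<lambda>\<omega>. noise_coord s t i \<omega> * noise_coord s t j \<omega>) =
      (if i = j \<and> 0 < lam i then t - s else 0)"
proof (cases "0 < lam i \<and> 0 < lam j")
  case True
  have [measurable]: "noise_coord s t n \<in> borel_measurable P" for n
    using st by (intro measurable_P[OF noise_coord_measurable]) auto
  have [measurable]: "\<beta> n t \<in> borel_measurable P" "\<beta> n s \<in> borel_measurable P" for n
    using st by (auto intro: beta_measurable)
  have "AE \<omega> in P. noise_coord s t i \<omega> = \<beta> i t \<omega> - \<beta> i s \<omega>"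
    "AE \<omega> in P. noise_coord s t j \<omega> = \<beta> j t \<omega> - \<beta> j s \<omega>"
    using st True by (auto intro!: noise_coord_AE)
  then have AE: "AE \<omega> in P. noise_coord s t i \<omega> * noise_coord s t j \<omega> =
      (\<beta> i t \<omega> - \<beta> i s \<omega>) * (\<beta> j t \<omega> - \<beta> j s \<omega>)"
    by eventually_elim simp
  show ?thesis
    using increment_uncorrelated[OF st, of i j] increment_moments(3,4)[OF st, of i] True
      integrable_cong_AE[OF _ _ AE] integral_cong_AE[OF _ _ AE]
    by (cases "i = j") (simp_all add: power2_eq_square)
qed (auto simp: normalized_coord_def)

text \<open>The preimages under \<open>X\<close> and under \<open>g\<close> of the increment lie in
  the two families declared independent by \<open>Q_wiener\<close>. They are stable under
  intersection, so independence extends to the generated sigma-algebras, and the expectation of the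
  product factorises.\<close>

lemma independent_of_past:
  fixes X :: "'w \<Rightarrow> real" and g :: "'h \<Rightarrow> real"
  assumes st: "0 \<le> s" "s \<le> t" "t \<le> T"
    and X: "X \<in> borel_measurable (\<FF> s)" "integrable P X"
    and g: "g \<in> borel_measurable borel" "integrable P (\<lambda>\<omega>. g (W t \<omega> - W s \<omega>))"
  shows "integrable P (\<lambda>\<omega>. X \<omega> * g (W t \<omega> - W s \<omega>))"
    "expectation (\<lambda>\<omega>. X \<omega> * g (W t \<omega> - W s \<omega>)) = expectation X * expectation (\<lambda>\<omega>. g (W t \<omega> - W s \<omega>))"
proof -
  let ?Y = "\<lambda>\<omega>. g (W t \<omega> - W s \<omega>)"
  let ?dW = "{(\<lambda>\<omega>. W t \<omega> - W s \<omega>) -` A \<inter> space P | A. A \<in> sets borel}"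
  have indep: "indep_set (sets (\<FF> s)) ?dW"
    using wiener st by (simp add: Q_wiener_def)
  have sp: "space (\<FF> s) = space P" using subalg[of s] st by (simp add: subalgebra_def)
  have "indep_set {X -` A \<inter> space P | A. A \<in> sets borel} {?Y -` A \<inter> space P | A. A \<in> sets borel}"
    unfolding indep_set_def
  proof (rule indep_sets_mono_sets[OF indep[unfolded indep_set_def]])
    fix i :: bool
    have "X -` A \<inter> space P \<in> sets (\<FF> s)" if "A \<in> sets borel" for A
      using measurable_sets[OF X(1) that] by (simp add: sp)
    moreover have "?Y -` A \<inter> space P \<in> ?dW" if "A \<in> sets borel" for A
      using measurable_sets[OF g(1) that] by (auto intro!: exI[of _ "g -` A"])
    ultimately show "(case i of True \<Rightarrow> {X -` A \<inter> space P | A. A \<in> sets borel}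
          | False \<Rightarrow> {?Y -` A \<inter> space P | A. A \<in> sets borel})
        \<subseteq> (case i of True \<Rightarrow> sets (\<FF> s) | False \<Rightarrow> ?dW)"
      by (cases i) auto
  qed
  moreover have "Int_stable {f -` A \<inter> space P | A. A \<in> sets borel}" for f :: "'w \<Rightarrow> real"
  proof (rule Int_stableI, safe)
    fix A B :: "real set" assume "A \<in> sets borel" "B \<in> sets borel"
    then show "\<exists>C. f -` A \<inter> space P \<inter> (f -` B \<inter> space P) = f -` C \<inter> space P \<and> C \<in> sets borel"
      by (intro exI[of _ "A \<inter> B"]) auto
  qed
  ultimately have "indep_var borel X borel ?Y"
    unfolding indep_var_eq using X(2) g(2) by (auto intro!: indep_set_sigma_sets)
  then show "integrable P (\<lambda>\<omega>. X \<omega> * g (W t \<omega> - W s \<omega>))"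
    "expectation (\<lambda>\<omega>. X \<omega> * g (W t \<omega> - W s \<omega>)) = expectation X * expectation (\<lambda>\<omega>. g (W t \<omega> - W s \<omega>))"
    using X(2) g(2) by (auto intro: indep_var_integrable simp: indep_var_lebesgue_integral)
qed

text \<open>First and second moments of the noise factor out of any weight known at time
  \<open>s\<close>: the scalar core of both the isometry and the orthogonality below.\<close>

lemma noise_coord_mult:
  fixes X :: "'w \<Rightarrow> real"
  assumes st: "0 \<le> s" "s < t" "t \<le> T"
    and X: "X \<in> borel_measurable (\<FF> s)" "integrable P X"
  shows "integrable P (\<lambda>\<omega>. noise_coord s t i \<omega> * X \<omega>)"
    "expectation (\<lambda>\<omega>. noise_coord s t i \<omega> * X \<omega>) = 0"
    "integrable P (\<lambda>\<omega>. (noise_coord s t i \<omega> * noise_coord s t j \<omega>) * X \<omega>)"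
    "expectation (\<lambda>\<omega>. (noise_coord s t i \<omega> * noise_coord s t j \<omega>) * X \<omega>) =
      (if i = j \<and> 0 < lam i then t - s else 0) * expectation X"
  using independent_of_past[OF st(1) less_imp_le[OF st(2)] st(3) X, of "normalized_coord e lam i"]
    independent_of_past[OF st(1) less_imp_le[OF st(2)] st(3) X,
      of "\<lambda>x. normalized_coord e lam i x * normalized_coord e lam j x"]
    noise_coord_mean[OF st, of i] noise_coord_covariance[OF st, of i j]
  by (simp_all add: mult.commute mult.left_commute)

text \<open>The Ito isometry for one step and finitely many modes: independent modes kill the mixed
  terms. It is an inequality because a mode with \<open>lam n = 0\<close> contributes nothing,
  whatever \<open>a n\<close> is.\<close>

lemma noise_sum:
  fixes a :: "nat \<Rightarrow> 'w \<Rightarrow> 'h"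
  assumes st: "0 \<le> s" "s < t" "t \<le> T"
    and a: "\<And>n. a n \<in> borel_measurable (\<FF> s)" "\<And>n. square_integrable_rv P (a n)"
    and "finite A"
  shows "square_integrable_rv P (\<lambda>\<omega>. \<Sum>n\<in>A. noise_coord s t n \<omega> *\<^sub>R a n \<omega>)"
    "(L2_norm P (\<lambda>\<omega>. \<Sum>n\<in>A. noise_coord s t n \<omega> *\<^sub>R a n \<omega>))\<^sup>2 \<le>
      (t - s) * (\<Sum>n\<in>A. (L2_norm P (a n))\<^sup>2)"
proof -
  have [measurable]: "noise_coord s t n \<in> borel_measurable P" for n
    using st by (intro measurable_P[OF noise_coord_measurable]) auto
  have [measurable]: "a n \<in> borel_measurable P" for n
    using a(2) by (rule square_integrable_rv_measurable)
  have sq_eq: "(norm (noise_coord s t n \<omega> *\<^sub>R a n \<omega>))\<^sup>2 =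
      (noise_coord s t n \<omega> * noise_coord s t n \<omega>) * (norm (a n \<omega>))\<^sup>2" for n \<omega>
    by (simp add: power_mult_distrib power2_eq_square[of "noise_coord s t n \<omega>"])
  have meas_inner: "(\<lambda>\<omega>. a i \<omega> \<bullet> a j \<omega>) \<in> borel_measurable (\<FF> s)"
    and meas_sq: "(\<lambda>\<omega>. (norm (a i \<omega>))\<^sup>2) \<in> borel_measurable (\<FF> s)" for i j
    using a(1)[of i] a(1)[of j] by measurable
  note inner = noise_coord_mult(3,4)[OF st meas_inner integrable_inner_square_integrable[OF a(2) a(2)]]
  note sq = noise_coord_mult(3,4)[OF st meas_sq square_integrable_rv_integrable[OF a(2)]]
  have sqi: "square_integrable_rv P (\<lambda>\<omega>. noise_coord s t n \<omega> *\<^sub>R a n \<omega>)" for n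
    unfolding square_integrable_rv_def sq_eq using sq(1) by simp
  then show "square_integrable_rv P (\<lambda>\<omega>. \<Sum>n\<in>A. noise_coord s t n \<omega> *\<^sub>R a n \<omega>)"
    by (rule square_integrable_rv_sum)
  have "(L2_norm P (\<lambda>\<omega>. \<Sum>n\<in>A. noise_coord s t n \<omega> *\<^sub>R a n \<omega>))\<^sup>2 =
      (\<Sum>n\<in>A. (L2_norm P (\<lambda>\<omega>. noise_coord s t n \<omega> *\<^sub>R a n \<omega>))\<^sup>2)"
  proof (rule L2_norm_sum_orthogonal[OF \<open>finite A\<close> sqi])
    fix i j :: nat assume "i \<noteq> j"
    then show "expectation (\<lambda>\<omega>. (noise_coord s t i \<omega> *\<^sub>R a i \<omega>) \<bullet> (noise_coord s t j \<omega> *\<^sub>R a j \<omega>)) = 0"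
      using inner(2)[of i j i j] by (simp add: mult.assoc mult.left_commute)
  qed
  also have "\<dots> \<le> (\<Sum>n\<in>A. (t - s) * (L2_norm P (a n))\<^sup>2)"
    unfolding L2_norm_sq sq_eq sq(2) using st by (intro sum_mono mult_right_mono) auto
  finally show "(L2_norm P (\<lambda>\<omega>. \<Sum>n\<in>A. noise_coord s t n \<omega> *\<^sub>R a n \<omega>))\<^sup>2 \<le>
      (t - s) * (\<Sum>n\<in>A. (L2_norm P (a n))\<^sup>2)"
    by (simp add: sum_distrib_left)
qed

text \<open>The martingale-difference property: given the past, each increment has mean 0. The
  operator \<open>R\<close> is there for the semigroup that later carries the noise to the end of
  the coarse interval.\<close>

lemma noise_sum_orthogonal:
  fixes a :: "nat \<Rightarrow> 'w \<Rightarrow> 'h" and Z :: "'w \<Rightarrow> 'h"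
  assumes st: "0 \<le> s" "s < t" "t \<le> T"
    and a: "\<And>n. a n \<in> borel_measurable (\<FF> s)" "\<And>n. square_integrable_rv P (a n)"
    and Z: "Z \<in> borel_measurable (\<FF> s)" "square_integrable_rv P Z"
    and R: "bounded_linear R"
  shows "expectation (\<lambda>\<omega>. Z \<omega> \<bullet> R (\<Sum>n\<in>A. noise_coord s t n \<omega> *\<^sub>R a n \<omega>)) = 0"
proof -
  interpret R: bounded_linear R by fact
  have [measurable]: "R \<in> borel_measurable borel"
    using R by (simp add: borel_measurable_continuous_onI linear_continuous_on)
  have meas: "(\<lambda>\<omega>. Z \<omega> \<bullet> R (a n \<omega>)) \<in> borel_measurable (\<FF> s)" for n
    using a(1)[of n] Z(1) by measurable
  note mult = noise_coord_mult(1,2)[OF st meas integrable_inner_square_integrable[OF Z(2)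
        square_integrable_rv_bounded_linear[OF R a(2)]]]
  show ?thesis
    by (simp add: R.sum R.scaleR inner_sum_right mult)
qed

end

section \<open>The exponential integrator\<close>

text \<open>Here \<open>M\<close> bounds the semigroup and is not the Maxwell operator.
  \<open>L\<close> and \<open>K\<close> are Lipschitz constants of drift and diffusion, uniform in
  time; in the application \<open>K\<close> includes the Hilbert-Schmidt norm of
  \<open>sqrt_op e lam\<close>.\<close>

locale exp_integrator = wiener_setting P T \<FF> e lam \<beta> W
  for P :: "'w measure" and T :: real and \<FF> :: "real \<Rightarrow> 'w measure"
    and e :: "nat \<Rightarrow> 'h::{real_inner, banach, second_countable_topology}" and lam :: "nat \<Rightarrow> real"
    and \<beta> :: "nat \<Rightarrow> real \<Rightarrow> 'w \<Rightarrow> real" and W :: "real \<Rightarrow> 'w \<Rightarrow> 'h" +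
  fixes S :: "real \<Rightarrow> 'h \<Rightarrow> 'h" and F :: "real \<Rightarrow> 'h \<Rightarrow> 'h" and B :: "real \<Rightarrow> 'h \<Rightarrow> 'h \<Rightarrow> 'h"
    and M L K :: real
  assumes T_nonneg: "0 \<le> T"
    and S: "C0_semigroup S"
    and M: "1 \<le> M" and S_bound: "\<And>t x. 0 \<le> t \<Longrightarrow> t \<le> T \<Longrightarrow> norm (S t x) \<le> M * norm x"
    and L: "0 \<le> L"
    and F_lipschitz: "\<And>t u v. 0 \<le> t \<Longrightarrow> t \<le> T \<Longrightarrow> norm (F t u - F t v) \<le> L * norm (u - v)"
    and K: "0 \<le> K"
    and B_HS0: "\<And>t u. 0 \<le> t \<Longrightarrow> t \<le> T \<Longrightarrow> B t u \<in> HS0 e lam"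
    and B_growth: "\<And>t u. 0 \<le> t \<Longrightarrow> t \<le> T \<Longrightarrow> hs0_norm e lam (B t u) \<le> K * sqrt (1 + (norm u)\<^sup>2)"
    and B_lipschitz: "\<And>t u v. 0 \<le> t \<Longrightarrow> t \<le> T \<Longrightarrow>
      hs0_norm e lam (\<lambda>x. B t u x - B t v x) \<le> K * norm (u - v)"
begin

section \<open>Adapted square-integrable random variables\<close>

definition adapted_L2 :: "real \<Rightarrow> ('w \<Rightarrow> 'h) \<Rightarrow> bool" where
  "adapted_L2 t u \<longleftrightarrow> u \<in> borel_measurable (\<FF> t) \<and> square_integrable_rv P u"

lemma adapted_L2_D:
  "adapted_L2 t u \<Longrightarrow> u \<in> borel_measurable (\<FF> t)"
  "adapted_L2 t u \<Longrightarrow> square_integrable_rv P u"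
  by (simp_all add: adapted_L2_def)

lemma adapted_L2_later:
  "adapted_L2 s u \<Longrightarrow> 0 \<le> s \<Longrightarrow> s \<le> t \<Longrightarrow> t \<le> T \<Longrightarrow> adapted_L2 t u"
  using measurable_later by (auto simp: adapted_L2_def)

lemma adapted_L2_add: "adapted_L2 t u \<Longrightarrow> adapted_L2 t v \<Longrightarrow> adapted_L2 t (\<lambda>\<omega>. u \<omega> + v \<omega>)"
  by (auto simp: adapted_L2_def intro: square_integrable_rv_add)

lemma adapted_L2_diff: "adapted_L2 t u \<Longrightarrow> adapted_L2 t v \<Longrightarrow> adapted_L2 t (\<lambda>\<omega>. u \<omega> - v \<omega>)"
  by (auto simp: adapted_L2_def intro: square_integrable_rv_diff)

lemma adapted_L2_scaleR: "adapted_L2 t u \<Longrightarrow> adapted_L2 t (\<lambda>\<omega>. c *\<^sub>R u \<omega>)"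
  by (auto simp: adapted_L2_def intro: square_integrable_rv_scaleR)

lemma S_linear: "0 \<le> t \<Longrightarrow> bounded_linear (S t)"
  using S by (simp add: C0_semigroup_def)

lemma S_add: "0 \<le> s \<Longrightarrow> 0 \<le> t \<Longrightarrow> S (s + t) u = S s (S t u)"
  using S by (simp add: C0_semigroup_def)

lemma S_0: "S 0 u = u"
  using S by (simp add: C0_semigroup_def)

lemma S_square_integrable:
  "0 \<le> t \<Longrightarrow> square_integrable_rv P u \<Longrightarrow> square_integrable_rv P (\<lambda>\<omega>. S t (u \<omega>))"
  by (rule square_integrable_rv_bounded_linear[OF S_linear])

lemma adapted_L2_S:
  assumes "0 \<le> r" "adapted_L2 t u"
  shows "adapted_L2 t (\<lambda>\<omega>. S r (u \<omega>))"
proof -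
  have [measurable]: "S r \<in> borel_measurable borel"
    using S_linear[OF assms(1)] by (simp add: borel_measurable_continuous_onI linear_continuous_on)
  show ?thesis
    using assms(2) S_square_integrable[OF assms(1), of u]
    by (simp add: adapted_L2_def measurable_compose[OF _ \<open>S r \<in> borel_measurable borel\<close>])
qed

lemma L2_norm_S:
  assumes "0 \<le> t" "t \<le> T" "square_integrable_rv P u"
  shows "L2_norm P (\<lambda>\<omega>. S t (u \<omega>)) \<le> M * L2_norm P u"
  using assms M by (intro L2_norm_mono S_square_integrable S_bound) auto

lemma adapted_L2_F:
  assumes s: "0 \<le> s" "s \<le> T" and u: "adapted_L2 t u" and t: "0 \<le> t" "t \<le> T"
  shows "adapted_L2 t (\<lambda>\<omega>. F s (u \<omega>))"
proof -
  have "continuous_on UNIV (F s)"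
    by (rule lipschitz_on_continuous_on[of L]) (use F_lipschitz[OF s] L in \<open>auto simp: lipschitz_on_def dist_norm\<close>)
  then have [measurable]: "F s \<in> borel_measurable borel" by (rule borel_measurable_continuous_onI)
  note [measurable] = adapted_L2_D(1)[OF u]
  note [measurable] = measurable_P[OF adapted_L2_D(1)[OF u] t]
  have "square_integrable_rv P (\<lambda>\<omega>. F s (u \<omega>))"
  proof (rule square_integrable_rv_dominated)
    show "integrable P (\<lambda>\<omega>. 2 * L\<^sup>2 * (norm (u \<omega>))\<^sup>2 + 2 * (norm (F s 0))\<^sup>2)"
      using square_integrable_rv_integrable[OF adapted_L2_D(2)[OF u]] by simp
    fix \<omega>
    have "(norm ((F s (u \<omega>) - F s 0) + F s 0))\<^sup>2 \<le> 2 * (norm (F s (u \<omega>) - F s 0))\<^sup>2 + 2 * (norm (F s 0))\<^sup>2"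
      by (rule norm_add_sq_le)
    also have "(norm (F s (u \<omega>) - F s 0))\<^sup>2 \<le> (L * norm (u \<omega>))\<^sup>2"
      using F_lipschitz[OF s, of "u \<omega>" 0] by (intro power_mono) auto
    finally show "(norm (F s (u \<omega>)))\<^sup>2 \<le> 2 * L\<^sup>2 * (norm (u \<omega>))\<^sup>2 + 2 * (norm (F s 0))\<^sup>2"
      by (simp add: power_mult_distrib)
  qed measurable
  then show ?thesis by (simp add: adapted_L2_def)
qed

abbreviation B_coef :: "real \<Rightarrow> ('w \<Rightarrow> 'h) \<Rightarrow> nat \<Rightarrow> 'w \<Rightarrow> 'h" where
  "B_coef s u n \<equiv> \<lambda>\<omega>. sqrt_coef e lam (B s (u \<omega>)) n"

text \<open>Kept to finite sums, so that integrating over the probability space requires no exchange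
  of integral and series; a single index gives the Lipschitz continuity of each column.\<close>

lemma sum_B_coef_diff:
  assumes s: "0 \<le> s" "s \<le> T" and "finite A"
  shows "(\<Sum>n\<in>A. (norm (sqrt_coef e lam (B s x) n - sqrt_coef e lam (B s y) n))\<^sup>2) \<le> K\<^sup>2 * (norm (x - y))\<^sup>2"
proof -
  note sm = summable_sqrt_coef_diff[OF B_HS0[OF s] B_HS0[OF s], of x y]
  have "(\<Sum>n\<in>A. (norm (sqrt_coef e lam (B s x) n - sqrt_coef e lam (B s y) n))\<^sup>2)
      \<le> (hs0_norm e lam (\<lambda>z. B s x z - B s y z))\<^sup>2"
    using sum_sqrt_coef_le[OF sm \<open>finite A\<close>] by (simp add: sqrt_coef_diff)
  also have "\<dots> \<le> (K * norm (x - y))\<^sup>2"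
    using B_lipschitz[OF s] hs0_norm_nonneg[OF sm] by (intro power_mono) auto
  finally show ?thesis by (simp add: power_mult_distrib)
qed

lemma sum_B_coef:
  assumes s: "0 \<le> s" "s \<le> T" and "finite A"
  shows "(\<Sum>n\<in>A. (norm (sqrt_coef e lam (B s x) n))\<^sup>2) \<le> K\<^sup>2 * (1 + (norm x)\<^sup>2)"
proof -
  have "(\<Sum>n\<in>A. (norm (sqrt_coef e lam (B s x) n))\<^sup>2) \<le> (hs0_norm e lam (B s x))\<^sup>2"
    by (rule sum_sqrt_coef_le[OF summable_sqrt_coef[OF B_HS0[OF s]] \<open>finite A\<close>])
  also have "\<dots> \<le> (K * sqrt (1 + (norm x)\<^sup>2))\<^sup>2"
    using B_growth[OF s] hs0_norm_nonneg[OF summable_sqrt_coef[OF B_HS0[OF s]]] by (intro power_mono) auto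
  finally show ?thesis by (simp add: power_mult_distrib)
qed

text \<open>Measurability of the operator-valued map \<open>B s\<close> is obtained column by
  column: every column is Lipschitz in the state, hence continuous and Borel.\<close>

lemma B_coef_adapted:
  assumes s: "0 \<le> s" "s \<le> T" and u: "adapted_L2 s u"
  shows "adapted_L2 s (B_coef s u n)"
proof -
  have "norm (sqrt_coef e lam (B s x) n - sqrt_coef e lam (B s y) n) \<le> K * norm (x - y)" for x y
  proof (rule power2_le_imp_le)
    show "(norm (sqrt_coef e lam (B s x) n - sqrt_coef e lam (B s y) n))\<^sup>2 \<le> (K * norm (x - y))\<^sup>2"
      using sum_B_coef_diff[OF s, of "{n}" x y] by (simp add: power_mult_distrib)
  qed (use K in simp)
  then have "continuous_on UNIV (\<lambda>x. sqrt_coef e lam (B s x) n)"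
    using K by (intro lipschitz_on_continuous_on[of K]) (auto simp: lipschitz_on_def dist_norm)
  then have [measurable]: "(\<lambda>x. sqrt_coef e lam (B s x) n) \<in> borel_measurable borel"
    by (rule borel_measurable_continuous_onI)
  note [measurable] = adapted_L2_D(1)[OF u]
  note [measurable] = measurable_P[OF adapted_L2_D(1)[OF u] s]
  have "square_integrable_rv P (B_coef s u n)"
  proof (rule square_integrable_rv_dominated)
    show "integrable P (\<lambda>\<omega>. K\<^sup>2 * (1 + (norm (u \<omega>))\<^sup>2))"
      using square_integrable_rv_integrable[OF adapted_L2_D(2)[OF u]] by simp
    show "(norm (B_coef s u n \<omega>))\<^sup>2 \<le> K\<^sup>2 * (1 + (norm (u \<omega>))\<^sup>2)" for \<omega>
      using sum_B_coef[OF s, of "{n}" "u \<omega>"] by simp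
  qed measurable
  then show ?thesis by (simp add: adapted_L2_def)
qed

lemma summable_B_coef:
  assumes s: "0 \<le> s" "s \<le> T" and u: "adapted_L2 s u"
  shows "summable (\<lambda>n. (L2_norm P (B_coef s u n))\<^sup>2)"
proof (rule summableI_nonneg_bounded)
  fix m
  note int = square_integrable_rv_integrable[OF adapted_L2_D(2)[OF B_coef_adapted[OF s u]]]
  have "(\<Sum>n<m. (L2_norm P (B_coef s u n))\<^sup>2) = (\<integral>\<omega>. (\<Sum>n<m. (norm (B_coef s u n \<omega>))\<^sup>2) \<partial>P)"
    by (simp add: L2_norm_sq int)
  also have "\<dots> \<le> (\<integral>\<omega>. K\<^sup>2 * (1 + (norm (u \<omega>))\<^sup>2) \<partial>P)"
    using square_integrable_rv_integrable[OF adapted_L2_D(2)[OF u]]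
    by (intro integral_mono Bochner_Integration.integrable_sum int sum_B_coef s) auto
  finally show "(\<Sum>n<m. (L2_norm P (B_coef s u n))\<^sup>2) \<le> (\<integral>\<omega>. K\<^sup>2 * (1 + (norm (u \<omega>))\<^sup>2) \<partial>P)" .
qed simp

section \<open>The noise increment as a mean-square limit of truncations\<close>

abbreviation truncated_increment :: "real \<Rightarrow> real \<Rightarrow> ('w \<Rightarrow> 'h) \<Rightarrow> nat \<Rightarrow> 'w \<Rightarrow> 'h" where
  "truncated_increment s t u m \<equiv> \<lambda>\<omega>. B s (u \<omega>) (U0_truncation e lam m (W t \<omega> - W s \<omega>))"

abbreviation stoch_increment :: "real \<Rightarrow> real \<Rightarrow> ('w \<Rightarrow> 'h) \<Rightarrow> 'w \<Rightarrow> 'h" where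
  "stoch_increment s t u \<equiv>
     apply_to_increment P (\<FF> t) e lam (\<lambda>\<omega>. B s (u \<omega>)) (\<lambda>\<omega>. W t \<omega> - W s \<omega>)"

lemma truncated_increment_eq:
  assumes s: "0 \<le> s" "s \<le> T"
  shows "B s x (U0_truncation e lam m y) =
    (\<Sum>n<m. normalized_coord e lam n y *\<^sub>R sqrt_coef e lam (B s x) n)"
  by (rule HS0_U0_truncation[OF orthonormal lam_nonneg B_HS0[OF s]])

lemma truncated_increment_adapted:
  assumes st: "0 \<le> s" "s < t" "t \<le> T" and u: "adapted_L2 s u"
  shows "adapted_L2 t (truncated_increment s t u m)"
proof -
  have s: "0 \<le> s" "s \<le> T" using st by auto
  note coef = B_coef_adapted[OF s u]
  have [measurable]: "noise_coord s t n \<in> borel_measurable (\<FF> t)" for n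
    using st by (intro noise_coord_measurable) auto
  have [measurable]: "B_coef s u n \<in> borel_measurable (\<FF> t)" for n
    using adapted_L2_D(1)[OF adapted_L2_later[OF coef]] st by auto
  show ?thesis
    unfolding adapted_L2_def truncated_increment_eq[OF s]
    using noise_sum(1)[OF st adapted_L2_D(1)[OF coef] adapted_L2_D(2)[OF coef]] by simp
qed

text \<open>Two truncations differ by a block of modes, whose size the isometry bounds by a block of
  the convergent series in \<open>summable_B_coef\<close>.\<close>

lemma truncated_increment_Cauchy:
  assumes st: "0 \<le> s" "s < t" "t \<le> T" and u: "adapted_L2 s u" and "0 < \<epsilon>"
  shows "\<exists>N. \<forall>i\<ge>N. \<forall>j\<ge>N.
    L2_norm P (\<lambda>\<omega>. truncated_increment s t u i \<omega> - truncated_increment s t u j \<omega>) < \<epsilon>"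
proof -
  have s: "0 \<le> s" "s \<le> T" using st by auto
  note coef = B_coef_adapted[OF s u]
  have "0 < \<epsilon>\<^sup>2 / (t - s)" using st \<open>0 < \<epsilon>\<close> by simp
  then obtain N where N: "\<And>m n. m \<ge> N \<Longrightarrow> norm (\<Sum>k=m..<n. (L2_norm P (B_coef s u k))\<^sup>2) < \<epsilon>\<^sup>2 / (t - s)"
    using summable_B_coef[OF s u] unfolding summable_Cauchy by blast
  have le: "L2_norm P (\<lambda>\<omega>. truncated_increment s t u i \<omega> - truncated_increment s t u j \<omega>) < \<epsilon>"
    if "N \<le> j" "j \<le> i" for i j
  proof -
    have "(\<lambda>\<omega>. truncated_increment s t u i \<omega> - truncated_increment s t u j \<omega>) =
        (\<lambda>\<omega>. \<Sum>n=j..<i. noise_coord s t n \<omega> *\<^sub>R B_coef s u n \<omega>)"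
      unfolding truncated_increment_eq[OF s] using \<open>j \<le> i\<close>
      by (simp add: sum_diff_nat_ivl[of 0] lessThan_atLeast0)
    then have "(L2_norm P (\<lambda>\<omega>. truncated_increment s t u i \<omega> - truncated_increment s t u j \<omega>))\<^sup>2
        \<le> (t - s) * (\<Sum>n=j..<i. (L2_norm P (B_coef s u n))\<^sup>2)"
      using noise_sum(2)[OF st adapted_L2_D(1)[OF coef] adapted_L2_D(2)[OF coef]] by simp
    also have "\<dots> < (t - s) * (\<epsilon>\<^sup>2 / (t - s))"
      using N[OF \<open>N \<le> j\<close>, of i] st by (intro mult_strict_left_mono) auto
    also have "\<dots> = \<epsilon>\<^sup>2" using st by simp
    finally show ?thesis using \<open>0 < \<epsilon>\<close> power_less_imp_less_base by fastforce
  qed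
  show ?thesis
  proof (intro exI allI impI)
    fix i j assume "N \<le> i" "N \<le> j"
    then show "L2_norm P (\<lambda>\<omega>. truncated_increment s t u i \<omega> - truncated_increment s t u j \<omega>) < \<epsilon>"
      using le[of i j] le[of j i]
        L2_norm_minus_commute[of P "truncated_increment s t u i" "truncated_increment s t u j"]
      by (cases "i \<le> j") auto
  qed
qed

text \<open>The Cauchy property makes the predicate under \<open>SOME\<close> satisfiable, so the
  chosen variable really is the limit. Everything later about \<open>B dW\<close> rests on
  this.\<close>

lemma stoch_increment:
  assumes st: "0 \<le> s" "s < t" "t \<le> T" and u: "adapted_L2 s u"
  shows "adapted_L2 t (stoch_increment s t u)"
    "(\<lambda>m. L2_norm P (\<lambda>\<omega>. stoch_increment s t u \<omega> - truncated_increment s t u m \<omega>)) \<longlonglongrightarrow> 0"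
proof -
  let ?Y = "stoch_increment s t u" and ?X = "truncated_increment s t u"
  have t: "0 \<le> t" "t \<le> T" using st by auto
  note X = truncated_increment_adapted[OF st u]
  have Y: "?Y \<in> borel_measurable (\<FF> t)"
    "(\<lambda>m. \<integral>\<^sup>+\<omega>. ennreal ((norm (?Y \<omega> - ?X m \<omega>))\<^sup>2) \<partial>P) \<longlonglongrightarrow> 0"
    using someI_ex[OF L2_Cauchy_limit[OF subalg[OF t] adapted_L2_D(1)[OF X] adapted_L2_D(2)[OF X]
          truncated_increment_Cauchy[OF st u]]]
    unfolding apply_to_increment_def by auto
  have [measurable]: "?Y \<in> borel_measurable P" "\<And>m. ?X m \<in> borel_measurable P"
    using measurable_P[OF Y(1) t] measurable_P[OF adapted_L2_D(1)[OF X] t] by auto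
  \<comment> \<open>The choice promises measurability and convergence, not square integrability; one
    truncation at finite distance from \<open>?Y\<close> supplies it.\<close>
  have "\<forall>\<^sub>F m in sequentially. (\<integral>\<^sup>+\<omega>. ennreal ((norm (?Y \<omega> - ?X m \<omega>))\<^sup>2) \<partial>P) < 1"
    using Y(2) by (rule order_tendstoD) simp
  then obtain m where "(\<integral>\<^sup>+\<omega>. ennreal ((norm (?Y \<omega> - ?X m \<omega>))\<^sup>2) \<partial>P) < 1"
    by (auto simp: eventually_sequentially)
  then have "square_integrable_rv P (\<lambda>\<omega>. ?Y \<omega> - ?X m \<omega>)"
    unfolding square_integrable_rv_def
    by (auto intro!: integrableI_bounded elim: order.strict_trans[OF _ ennreal_one_less_top])
  from square_integrable_rv_add[OF this adapted_L2_D(2)[OF X[of m]]]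
  have sq: "square_integrable_rv P ?Y" by simp
  with Y(1) show "adapted_L2 t ?Y" by (simp add: adapted_L2_def)
  have "(\<integral>\<^sup>+\<omega>. ennreal ((norm (?Y \<omega> - ?X m \<omega>))\<^sup>2) \<partial>P) =
      ennreal ((L2_norm P (\<lambda>\<omega>. ?Y \<omega> - ?X m \<omega>))\<^sup>2)" for m
    by (rule nn_integral_norm_sq[OF square_integrable_rv_diff[OF sq adapted_L2_D(2)[OF X]]])
  then have "(\<lambda>m. ennreal ((L2_norm P (\<lambda>\<omega>. ?Y \<omega> - ?X m \<omega>))\<^sup>2)) \<longlonglongrightarrow> ennreal 0"
    using Y(2) by simp
  then have "(\<lambda>m. (L2_norm P (\<lambda>\<omega>. ?Y \<omega> - ?X m \<omega>))\<^sup>2) \<longlonglongrightarrow> 0"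
    by (subst (asm) tendsto_ennreal_iff) auto
  from tendsto_real_sqrt[OF this]
  show "(\<lambda>m. L2_norm P (\<lambda>\<omega>. ?Y \<omega> - ?X m \<omega>)) \<longlonglongrightarrow> 0" by simp
qed

text \<open>The increments for \<open>u\<close> and \<open>v\<close> are chosen separately, so they
  are compared through their truncations: the isometry bounds the difference of truncations by
  \<open>D\<close>, and the two truncation errors vanish in the limit.\<close>

lemma stoch_increment_lipschitz:
  assumes st: "0 \<le> s" "s < t" "t \<le> T" and u: "adapted_L2 s u" and v: "adapted_L2 s v"
  shows "(L2_norm P (\<lambda>\<omega>. stoch_increment s t u \<omega> - stoch_increment s t v \<omega>))\<^sup>2
    \<le> (t - s) * K\<^sup>2 * (L2_norm P (\<lambda>\<omega>. u \<omega> - v \<omega>))\<^sup>2"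
proof -
  let ?Y = "stoch_increment s t" and ?X = "truncated_increment s t"
  have s: "0 \<le> s" "s \<le> T" using st by auto
  define D where "D = sqrt ((t - s) * K\<^sup>2 * (L2_norm P (\<lambda>\<omega>. u \<omega> - v \<omega>))\<^sup>2)"
  note Y = adapted_L2_D(2)[OF stoch_increment(1)[OF st]]
  note X = adapted_L2_D(2)[OF truncated_increment_adapted[OF st]]
  note coef = adapted_L2_diff[OF B_coef_adapted[OF s u] B_coef_adapted[OF s v]]
  note coef_int = square_integrable_rv_integrable[OF adapted_L2_D(2)[OF coef]]
  have XX: "L2_norm P (\<lambda>\<omega>. ?X u m \<omega> - ?X v m \<omega>) \<le> D" for m
  proof -
    have "(\<lambda>\<omega>. ?X u m \<omega> - ?X v m \<omega>) =
        (\<lambda>\<omega>. \<Sum>n<m. noise_coord s t n \<omega> *\<^sub>R (B_coef s u n \<omega> - B_coef s v n \<omega>))"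
      unfolding truncated_increment_eq[OF s] by (simp add: sum_subtractf scaleR_diff_right)
    then have "(L2_norm P (\<lambda>\<omega>. ?X u m \<omega> - ?X v m \<omega>))\<^sup>2 \<le>
        (t - s) * (\<Sum>n<m. (L2_norm P (\<lambda>\<omega>. B_coef s u n \<omega> - B_coef s v n \<omega>))\<^sup>2)"
      using noise_sum(2)[OF st adapted_L2_D(1)[OF coef] adapted_L2_D(2)[OF coef]] by simp
    also have "(\<Sum>n<m. (L2_norm P (\<lambda>\<omega>. B_coef s u n \<omega> - B_coef s v n \<omega>))\<^sup>2) =
        (\<integral>\<omega>. (\<Sum>n<m. (norm (B_coef s u n \<omega> - B_coef s v n \<omega>))\<^sup>2) \<partial>P)"
      by (simp add: L2_norm_sq coef_int)
    also have "\<dots> \<le> (\<integral>\<omega>. K\<^sup>2 * (norm (u \<omega> - v \<omega>))\<^sup>2 \<partial>P)"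
      using square_integrable_rv_integrable[OF adapted_L2_D(2)[OF adapted_L2_diff[OF u v]]]
      by (intro integral_mono Bochner_Integration.integrable_sum coef_int sum_B_coef_diff s) auto
    also have "\<dots> = K\<^sup>2 * (L2_norm P (\<lambda>\<omega>. u \<omega> - v \<omega>))\<^sup>2" by (simp add: L2_norm_sq)
    finally show ?thesis
      using st unfolding D_def by (intro real_le_rsqrt) (simp add: mult.assoc mult_left_mono)
  qed
  have "L2_norm P (\<lambda>\<omega>. ?Y u \<omega> - ?Y v \<omega>) \<le>
      L2_norm P (\<lambda>\<omega>. ?Y u \<omega> - ?X u m \<omega>) + D + L2_norm P (\<lambda>\<omega>. ?Y v \<omega> - ?X v m \<omega>)" for m
  proof -
    have "(\<lambda>\<omega>. ?Y u \<omega> - ?Y v \<omega>) =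
        (\<lambda>\<omega>. ((?Y u \<omega> - ?X u m \<omega>) + (?X u m \<omega> - ?X v m \<omega>)) + (?X v m \<omega> - ?Y v \<omega>))"
      by (simp add: algebra_simps)
    then have "L2_norm P (\<lambda>\<omega>. ?Y u \<omega> - ?Y v \<omega>) \<le>
        L2_norm P (\<lambda>\<omega>. (?Y u \<omega> - ?X u m \<omega>) + (?X u m \<omega> - ?X v m \<omega>)) + L2_norm P (\<lambda>\<omega>. ?X v m \<omega> - ?Y v \<omega>)"
      using L2_norm_triangle[of P "\<lambda>\<omega>. (?Y u \<omega> - ?X u m \<omega>) + (?X u m \<omega> - ?X v m \<omega>)" "\<lambda>\<omega>. ?X v m \<omega> - ?Y v \<omega>"]
      by (simp add: square_integrable_rv_add square_integrable_rv_diff X Y u v)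
    moreover have "L2_norm P (\<lambda>\<omega>. (?Y u \<omega> - ?X u m \<omega>) + (?X u m \<omega> - ?X v m \<omega>)) \<le>
        L2_norm P (\<lambda>\<omega>. ?Y u \<omega> - ?X u m \<omega>) + L2_norm P (\<lambda>\<omega>. ?X u m \<omega> - ?X v m \<omega>)"
      by (intro L2_norm_triangle square_integrable_rv_diff X Y u v)
    ultimately show ?thesis
      using XX[of m] L2_norm_minus_commute[of P "?X v m" "?Y v"] by linarith
  qed
  moreover have "(\<lambda>m. L2_norm P (\<lambda>\<omega>. ?Y u \<omega> - ?X u m \<omega>) + D + L2_norm P (\<lambda>\<omega>. ?Y v \<omega> - ?X v m \<omega>))
      \<longlonglongrightarrow> 0 + D + 0"
    by (intro tendsto_add tendsto_const stoch_increment(2) st u v)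
  ultimately have "L2_norm P (\<lambda>\<omega>. ?Y u \<omega> - ?Y v \<omega>) \<le> 0 + D + 0"
    by (intro LIMSEQ_le_const) auto
  then have "(L2_norm P (\<lambda>\<omega>. ?Y u \<omega> - ?Y v \<omega>))\<^sup>2 \<le> D\<^sup>2" by (intro power_mono) auto
  also have "D\<^sup>2 = (t - s) * K\<^sup>2 * (L2_norm P (\<lambda>\<omega>. u \<omega> - v \<omega>))\<^sup>2"
    unfolding D_def using st by simp
  finally show ?thesis .
qed

text \<open>The expectation is 0 for every truncation, and by Cauchy-Schwarz the truncation error,
  multiplied by the bound \<open>k\<close> of \<open>R\<close>, disappears in the limit.\<close>

lemma stoch_increment_orthogonal:
  assumes st: "0 \<le> s" "s < t" "t \<le> T" and u: "adapted_L2 s u" and Z: "adapted_L2 s Z"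
    and R: "bounded_linear R"
  shows "expectation (\<lambda>\<omega>. Z \<omega> \<bullet> R (stoch_increment s t u \<omega>)) = 0"
proof -
  interpret R: bounded_linear R by fact
  let ?Y = "stoch_increment s t u" and ?X = "truncated_increment s t u"
  have s: "0 \<le> s" "s \<le> T" using st by auto
  obtain k where k: "0 \<le> k" "\<And>x. norm (R x) \<le> norm x * k" using R.nonneg_bounded by blast
  note Y = adapted_L2_D(2)[OF stoch_increment(1)[OF st u]]
  note X = adapted_L2_D(2)[OF truncated_increment_adapted[OF st u]]
  note coef = B_coef_adapted[OF s u]
  note sqR = square_integrable_rv_bounded_linear[OF R]
  have "\<bar>expectation (\<lambda>\<omega>. Z \<omega> \<bullet> R (?Y \<omega>))\<bar> \<le> L2_norm P Z * (k * L2_norm P (\<lambda>\<omega>. ?Y \<omega> - ?X m \<omega>))" for m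
  proof -
    have "expectation (\<lambda>\<omega>. Z \<omega> \<bullet> R (?X m \<omega>)) = 0"
      unfolding truncated_increment_eq[OF s]
      by (rule noise_sum_orthogonal[OF st adapted_L2_D(1)[OF coef] adapted_L2_D(2)[OF coef]
            adapted_L2_D(1)[OF Z] adapted_L2_D(2)[OF Z] R])
    then have "\<bar>expectation (\<lambda>\<omega>. Z \<omega> \<bullet> R (?Y \<omega>))\<bar> = \<bar>expectation (\<lambda>\<omega>. Z \<omega> \<bullet> R (?Y \<omega> - ?X m \<omega>))\<bar>"
      by (simp add: R.diff inner_diff_right integrable_inner_square_integrable
          adapted_L2_D(2)[OF Z] sqR X Y)
    also have "\<dots> \<le> L2_norm P Z * L2_norm P (\<lambda>\<omega>. R (?Y \<omega> - ?X m \<omega>))"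
      by (intro abs_integral_inner_le adapted_L2_D(2)[OF Z] sqR square_integrable_rv_diff X Y)
    also have "\<dots> \<le> L2_norm P Z * (k * L2_norm P (\<lambda>\<omega>. ?Y \<omega> - ?X m \<omega>))"
    proof (rule mult_left_mono[OF _ L2_norm_nonneg])
      note YX = square_integrable_rv_diff[OF Y X]
      show "L2_norm P (\<lambda>\<omega>. R (?Y \<omega> - ?X m \<omega>)) \<le> k * L2_norm P (\<lambda>\<omega>. ?Y \<omega> - ?X m \<omega>)"
        by (rule L2_norm_mono[OF sqR[OF YX] YX _ k(1)]) (use k(2) in \<open>simp add: mult.commute\<close>)
    qed
    finally show ?thesis .
  qed
  moreover have "(\<lambda>m. L2_norm P Z * (k * L2_norm P (\<lambda>\<omega>. ?Y \<omega> - ?X m \<omega>))) \<longlonglongrightarrow> L2_norm P Z * (k * 0)"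
    by (intro tendsto_mult tendsto_const stoch_increment(2) st u)
  ultimately have "\<bar>expectation (\<lambda>\<omega>. Z \<omega> \<bullet> R (?Y \<omega>))\<bar> \<le> L2_norm P Z * (k * 0)"
    by (intro LIMSEQ_le_const) auto
  then show ?thesis by simp
qed

abbreviation integrator_step :: "real \<Rightarrow> real \<Rightarrow> ('w \<Rightarrow> 'h) \<Rightarrow> 'w \<Rightarrow> 'h" where
  "integrator_step \<equiv> exp_step P \<FF> e lam W S F B"

text \<open>With a single outer semigroup operator, steps can be composed by linearity and the
  semigroup law.\<close>

lemma integrator_step_eq:
  assumes "s \<le> t"
  shows "integrator_step s t u =
    (\<lambda>\<omega>. S (t - s) (u \<omega> + (t - s) *\<^sub>R F s (u \<omega>) + stoch_increment s t u \<omega>))"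
proof -
  interpret bounded_linear "S (t - s)" using assms by (intro S_linear) simp
  show ?thesis by (simp add: exp_step_def Let_def add scaleR)
qed

lemma integrator_step_adapted:
  assumes st: "0 \<le> s" "s < t" "t \<le> T" and u: "adapted_L2 s u"
  shows "adapted_L2 t (integrator_step s t u)"
proof -
  have *: "0 \<le> s" "s \<le> t" "s \<le> T" "0 \<le> t" "0 \<le> t - s" using st by auto
  show ?thesis
    unfolding integrator_step_eq[OF *(2)]
    by (intro adapted_L2_S adapted_L2_add adapted_L2_scaleR adapted_L2_F stoch_increment(1)
        adapted_L2_later[OF u] st u *)
qed

end

section \<open>The fine propagator\<close>

text \<open>The induction follows the right-hand side \<open>a + c * (\<Sum>i<j. x i)\<close>, which
  grows by a factor of at most \<open>1 + c\<close> per step.\<close>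

lemma discrete_gronwall:
  fixes x :: "nat \<Rightarrow> real"
  assumes "0 \<le> c" and rec: "\<And>j. j \<le> m \<Longrightarrow> x j \<le> a + c * (\<Sum>i<j. x i)" and "j \<le> m"
  shows "x j \<le> a * (1 + c) ^ j"
proof -
  have "a + c * (\<Sum>i<j. x i) \<le> a * (1 + c) ^ j" if "j \<le> m" for j
    using that
  proof (induction j)
    case (Suc j)
    have "a + c * (\<Sum>i<Suc j. x i) = (a + c * (\<Sum>i<j. x i)) + c * x j"
      by (simp add: algebra_simps)
    also have "\<dots> \<le> (1 + c) * (a + c * (\<Sum>i<j. x i))"
      using mult_left_mono[OF rec[of j] \<open>0 \<le> c\<close>] Suc.prems by (simp add: algebra_simps)
    also have "\<dots> \<le> (1 + c) * (a * (1 + c) ^ j)"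
      using Suc \<open>0 \<le> c\<close> by (intro mult_left_mono) auto
    finally show ?case by (simp add: algebra_simps)
  qed simp
  then show ?thesis using rec[of j] \<open>j \<le> m\<close> by fastforce
qed

context exp_integrator
begin

text \<open>The 2 comes from splitting a square into drift and noise, \<open>M\<^sup>2\<close> from
  the semigroup. The drift gives \<open>L\<^sup>2 * T\<close>, with one factor \<open>T\<close> from
  Cauchy-Schwarz over the steps; the noise gives \<open>K\<^sup>2\<close>.\<close>

definition incr_const :: real where "incr_const = 2 * M\<^sup>2 * (L\<^sup>2 * T + K\<^sup>2)"

text \<open>\<open>2 * M\<^sup>2\<close> bounds the freely propagated initial difference; the
  exponential is the Gronwall factor for \<open>c = 2 * incr_const * dt\<close> over a time of at
  most \<open>T\<close>.\<close>

definition growth_const :: real where "growth_const = 2 * M\<^sup>2 * exp (2 * incr_const * T)"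

lemma incr_const_nonneg: "0 \<le> incr_const"
  using T_nonneg by (simp add: incr_const_def)

lemma growth_const_ge_1: "1 \<le> growth_const"
proof -
  have "1 * 1 \<le> (2 * M\<^sup>2) * exp (2 * incr_const * T)"
  proof (rule mult_mono)
    show "1 \<le> 2 * M\<^sup>2" using one_le_power[OF M, of 2] by linarith
    show "1 \<le> exp (2 * incr_const * T)" using incr_const_nonneg T_nonneg by simp
  qed auto
  then show ?thesis by (simp add: growth_const_def)
qed

section \<open>Two fine trajectories with different initial values\<close>

context
  fixes t0 dt :: real and J :: nat and u v :: "'w \<Rightarrow> 'h"
  assumes t0: "0 \<le> t0" and dt: "0 < dt" and end_le: "t0 + real J * dt \<le> T"
    and u: "adapted_L2 t0 u" and v: "adapted_L2 t0 v"
begin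

definition "U j = fine_steps integrator_step t0 dt j u"
definition "V j = fine_steps integrator_step t0 dt j v"
definition "node j = t0 + real j * dt"
definition "Sd j = S (real j * dt)"

lemma node_mono: "i \<le> j \<Longrightarrow> node i \<le> node j"
  using dt by (simp add: node_def)

lemma node_Suc: "node j < node (Suc j)" "node (Suc j) - node j = dt"
  using dt by (simp_all add: node_def algebra_simps)

lemma node_le: "j \<le> J \<Longrightarrow> node j \<le> T"
  using node_mono[of j J] end_le by (simp add: node_def)

lemma node_nonneg: "0 \<le> node j"
  using t0 dt by (simp add: node_def)

lemma lag_bounds: "0 \<le> real j * dt" "j \<le> J \<Longrightarrow> real j * dt \<le> T"
  using node_le[of j] t0 dt by (simp_all add: node_def)

lemma Sd_linear: "bounded_linear (Sd j)"
  unfolding Sd_def by (intro S_linear lag_bounds)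

lemma Sd_0: "Sd 0 x = x"
  by (simp add: Sd_def S_0)

lemma Sd_Suc: "Sd (Suc j) x = S dt (Sd j x)"
  using S_add[of dt "real j * dt" x] lag_bounds(1)[of j] dt by (simp add: Sd_def algebra_simps)

lemma fine_steps_adapted:
  assumes "adapted_L2 t0 w" "j \<le> J"
  shows "adapted_L2 (node j) (fine_steps integrator_step t0 dt j w)"
  using assms(2)
proof (induction j)
  case 0
  then show ?case using assms(1) by (simp add: node_def)
next
  case (Suc j)
  then have "adapted_L2 (node (Suc j))
      (integrator_step (node j) (node (Suc j)) (fine_steps integrator_step t0 dt j w))"
    using node_le[of "Suc j"] by (intro integrator_step_adapted node_nonneg node_Suc) auto
  then show ?case by (simp add: node_def)
qed

lemma UV_adapted: "j \<le> J \<Longrightarrow> adapted_L2 (node j) (U j)" "j \<le> J \<Longrightarrow> adapted_L2 (node j) (V j)"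
  by (simp_all add: U_def V_def fine_steps_adapted u v)

lemma U_Suc: "U (Suc j) = integrator_step (node j) (node (Suc j)) (U j)"
  and V_Suc: "V (Suc j) = integrator_step (node j) (node (Suc j)) (V j)"
  by (simp_all add: U_def V_def node_def)

definition "drift_diff j = (\<lambda>\<omega>. F (node j) (U j \<omega>) - F (node j) (V j \<omega>))"

definition "noise_diff j = (\<lambda>\<omega>. stoch_increment (node j) (node (Suc j)) (U j) \<omega> -
  stoch_increment (node j) (node (Suc j)) (V j) \<omega>)"

definition "err j = L2_norm P (\<lambda>\<omega>. U j \<omega> - V j \<omega>)"

text \<open>At \<open>j = J\<close> the subtracted term is \<open>S dT (u - v)\<close>, which is the
  same for every number of fine steps and hence also for the coarse propagator.\<close>

definition "remainder j = (\<lambda>\<omega>. (U j \<omega> - V j \<omega>) - Sd j (u \<omega> - v \<omega>))"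

text \<open>Discrete variation of constants. The semigroup law merges all factors
  \<open>S dt\<close> acting on one contribution into a single operator, so that its bound is
  \<open>M\<close> and not a power of \<open>M\<close>.\<close>

lemma remainder_eq:
  "remainder j = (\<lambda>\<omega>. (\<Sum>i<j. Sd (j - i) (dt *\<^sub>R drift_diff i \<omega>)) +
    (\<Sum>i<j. Sd (j - i) (noise_diff i \<omega>)))"
proof -
  have "U j \<omega> - V j \<omega> = Sd j (u \<omega> - v \<omega>) +
      (\<Sum>i<j. Sd (j - i) (dt *\<^sub>R drift_diff i \<omega> + noise_diff i \<omega>))" for \<omega>
  proof (induction j)
    case 0
    then show ?case by (simp add: Sd_0 U_def V_def)
  next
    case (Suc j)
    interpret Sdt: bounded_linear "S dt" using dt by (intro S_linear) simp
    let ?x = "\<lambda>i. dt *\<^sub>R drift_diff i \<omega> + noise_diff i \<omega>"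
    have "U (Suc j) \<omega> - V (Suc j) \<omega> = S dt ((U j \<omega> - V j \<omega>) + ?x j)"
      unfolding U_Suc V_Suc integrator_step_eq[OF less_imp_le[OF node_Suc(1)]] node_Suc(2)
        drift_diff_def noise_diff_def
      by (simp add: Sdt.diff[symmetric] algebra_simps)
    \<comment> \<open>The newest contribution is also propagated by \<open>S dt\<close>; writing it
      with \<open>Sd 0\<close> lets it join the sum as the term \<open>i = j\<close>.\<close>
    also have "\<dots> = S dt (Sd j (u \<omega> - v \<omega>)) + (\<Sum>i<j. S dt (Sd (j - i) (?x i))) + S dt (Sd 0 (?x j))"
      unfolding Suc.IH Sdt.add Sdt.sum Sd_0 ..
    also have "\<dots> = Sd (Suc j) (u \<omega> - v \<omega>) + (\<Sum>i<Suc j. Sd (Suc j - i) (?x i))"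
      by (simp add: Sd_Suc[symmetric] Suc_diff_le add.assoc)
    finally show ?case .
  qed
  moreover have "Sd n (x + y) = Sd n x + Sd n y" for n x y
    by (rule linear_simps(1)[OF Sd_linear])
  ultimately show ?thesis by (simp add: remainder_def sum.distrib)
qed

lemma drift_diff_adapted: "j \<le> J \<Longrightarrow> adapted_L2 (node j) (drift_diff j)"
  unfolding drift_diff_def by (intro adapted_L2_diff adapted_L2_F UV_adapted node_nonneg node_le)

lemma noise_diff_adapted: "j < J \<Longrightarrow> adapted_L2 (node (Suc j)) (noise_diff j)"
  unfolding noise_diff_def
  by (intro adapted_L2_diff stoch_increment(1) UV_adapted node_nonneg node_le node_Suc) auto

lemma drift_diff_le:
  assumes "j \<le> J"
  shows "L2_norm P (drift_diff j) \<le> L * err j"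
  unfolding err_def
proof (rule L2_norm_mono[OF adapted_L2_D(2)[OF drift_diff_adapted[OF assms]] _ _ L])
  show "square_integrable_rv P (\<lambda>\<omega>. U j \<omega> - V j \<omega>)"
    by (rule adapted_L2_D(2)[OF adapted_L2_diff[OF UV_adapted[OF assms]]])
  show "norm (drift_diff j \<omega>) \<le> L * norm (U j \<omega> - V j \<omega>)" for \<omega>
    unfolding drift_diff_def by (intro F_lipschitz node_nonneg node_le assms)
qed

lemma noise_diff_le:
  assumes "j < J"
  shows "(L2_norm P (noise_diff j))\<^sup>2 \<le> dt * K\<^sup>2 * (err j)\<^sup>2"
proof -
  have "j \<le> J" "node (Suc j) \<le> T" using assms by (auto intro: node_le)
  from stoch_increment_lipschitz[OF node_nonneg node_Suc(1) this(2) UV_adapted[OF this(1)]]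
  show ?thesis unfolding noise_diff_def err_def node_Suc(2) .
qed

lemma noise_diff_orthogonal:
  assumes "j < J" and Z: "adapted_L2 (node j) Z" and R: "bounded_linear R"
  shows "expectation (\<lambda>\<omega>. Z \<omega> \<bullet> R (noise_diff j \<omega>)) = 0"
proof -
  interpret R: bounded_linear R by fact
  have le: "j \<le> J" "node (Suc j) \<le> T" using assms by (auto intro: node_le)
  note st = node_nonneg node_Suc(1) le(2)
  note UV = UV_adapted[OF le(1)]
  note int = integrable_inner_square_integrable[OF adapted_L2_D(2)[OF Z]
      square_integrable_rv_bounded_linear[OF R adapted_L2_D(2)[OF stoch_increment(1)[OF st]]]]
  show ?thesis
    unfolding noise_diff_def R.diff inner_diff_right
    by (subst Bochner_Integration.integral_diff[OF int[OF UV(1)] int[OF UV(2)]])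
      (use stoch_increment_orthogonal[OF st UV(1) Z R] stoch_increment_orthogonal[OF st UV(2) Z R] in simp)
qed

lemma Sd_bound:
  assumes "j \<le> J" "square_integrable_rv P w"
  shows "square_integrable_rv P (\<lambda>\<omega>. Sd (j - i) (w \<omega>))"
    "L2_norm P (\<lambda>\<omega>. Sd (j - i) (w \<omega>)) \<le> M * L2_norm P w"
proof -
  have "j - i \<le> J" using assms(1) by simp
  then show "square_integrable_rv P (\<lambda>\<omega>. Sd (j - i) (w \<omega>))"
    "L2_norm P (\<lambda>\<omega>. Sd (j - i) (w \<omega>)) \<le> M * L2_norm P w"
    unfolding Sd_def by (intro S_square_integrable L2_norm_S lag_bounds assms(2); assumption)+
qed

text \<open>The triangle inequality is affordable here, as each term carries a factor
  \<open>dt\<close>: squaring the sum costs a factor \<open>j\<close>, and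
  \<open>real j * dt \<le> T\<close>.\<close>

lemma drift_part_le:
  assumes "j \<le> J"
  shows "(L2_norm P (\<lambda>\<omega>. \<Sum>i<j. Sd (j - i) (dt *\<^sub>R drift_diff i \<omega>)))\<^sup>2
    \<le> M\<^sup>2 * L\<^sup>2 * T * dt * (\<Sum>i<j. (err i)\<^sup>2)"
proof -
  have sq: "square_integrable_rv P (\<lambda>\<omega>. dt *\<^sub>R drift_diff i \<omega>)" if "i < j" for i
    using that assms by (intro square_integrable_rv_scaleR adapted_L2_D(2)[OF drift_diff_adapted]) simp
  have "L2_norm P (\<lambda>\<omega>. \<Sum>i<j. Sd (j - i) (dt *\<^sub>R drift_diff i \<omega>))
      \<le> (\<Sum>i<j. L2_norm P (\<lambda>\<omega>. Sd (j - i) (dt *\<^sub>R drift_diff i \<omega>)))"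
    using sq Sd_bound(1)[OF assms] by (intro L2_norm_sum) auto
  also have "\<dots> \<le> (\<Sum>i<j. M * (dt * (L * err i)))"
  proof (rule sum_mono)
    fix i assume "i \<in> {..<j}"
    then have i: "i < j" by simp
    have "L2_norm P (\<lambda>\<omega>. Sd (j - i) (dt *\<^sub>R drift_diff i \<omega>))
        \<le> M * L2_norm P (\<lambda>\<omega>. dt *\<^sub>R drift_diff i \<omega>)"
      using sq[OF i] by (rule Sd_bound(2)[OF assms])
    also have "\<dots> \<le> M * (dt * (L * err i))"
      using drift_diff_le[of i] i assms dt M by (simp add: L2_norm_scaleR)
    finally show "L2_norm P (\<lambda>\<omega>. Sd (j - i) (dt *\<^sub>R drift_diff i \<omega>)) \<le> M * (dt * (L * err i))" .
  qed
  also have "\<dots> = M * L * dt * (\<Sum>i<j. err i)" by (simp add: sum_distrib_left mult_ac)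
  finally have "(L2_norm P (\<lambda>\<omega>. \<Sum>i<j. Sd (j - i) (dt *\<^sub>R drift_diff i \<omega>)))\<^sup>2
      \<le> (M * L * dt * (\<Sum>i<j. err i))\<^sup>2"
    by (intro power_mono) auto
  also have "\<dots> = M\<^sup>2 * L\<^sup>2 * dt\<^sup>2 * (\<Sum>i<j. err i)\<^sup>2" by (simp add: power_mult_distrib)
  also have "\<dots> \<le> M\<^sup>2 * L\<^sup>2 * dt\<^sup>2 * (real j * (\<Sum>i<j. (err i)\<^sup>2))"
    using sum_squared_le_sum_of_squares[of err "{..<j}"] by (intro mult_left_mono) (auto simp: mult.commute)
  also have "\<dots> = M\<^sup>2 * L\<^sup>2 * (real j * dt) * dt * (\<Sum>i<j. (err i)\<^sup>2)"
    by (simp add: power2_eq_square)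
  also have "\<dots> \<le> M\<^sup>2 * L\<^sup>2 * T * dt * (\<Sum>i<j. (err i)\<^sup>2)"
    using lag_bounds(2)[OF assms] dt by (intro mult_right_mono mult_left_mono sum_nonneg) auto
  finally show ?thesis .
qed

text \<open>Orthogonality of the noise contributions of different steps keeps this bound of order \<open>dt\<close> per
  step; the triangle inequality alone would give a constant growing with the number of fine steps.\<close>

lemma noise_part_le:
  assumes "j \<le> J"
  shows "(L2_norm P (\<lambda>\<omega>. \<Sum>i<j. Sd (j - i) (noise_diff i \<omega>)))\<^sup>2
    \<le> M\<^sup>2 * K\<^sup>2 * dt * (\<Sum>i<j. (err i)\<^sup>2)"
proof -
  have sq: "square_integrable_rv P (noise_diff i)" if "i < j" for i
    using that assms by (intro adapted_L2_D(2)[OF noise_diff_adapted]) simp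
  have lin: "bounded_linear (Sd (j - i))" for i
    by (rule Sd_linear)
  \<comment> \<open>For \<open>i < l\<close> the propagated noise of step \<open>i\<close> is known
    at \<open>node (Suc i)\<close>, hence at \<open>node l\<close>, where the noise of step
    \<open>l\<close> begins.\<close>
  have orth: "expectation (\<lambda>\<omega>. Sd (j - i) (noise_diff i \<omega>) \<bullet>
      Sd (j - l) (noise_diff l \<omega>)) = 0" if "i < l" "l < j" for i l
  proof (rule noise_diff_orthogonal[OF _ _ lin])
    show "l < J" using that assms by simp
    have "adapted_L2 (node (Suc i)) (\<lambda>\<omega>. Sd (j - i) (noise_diff i \<omega>))"
      unfolding Sd_def by (rule adapted_L2_S[OF lag_bounds(1) noise_diff_adapted]) (use that assms in simp)
    then show "adapted_L2 (node l) (\<lambda>\<omega>. Sd (j - i) (noise_diff i \<omega>))"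
      by (rule adapted_L2_later) (use that assms in \<open>auto intro: node_nonneg node_mono node_le\<close>)
  qed
  have "(L2_norm P (\<lambda>\<omega>. \<Sum>i<j. Sd (j - i) (noise_diff i \<omega>)))\<^sup>2 =
      (\<Sum>i<j. (L2_norm P (\<lambda>\<omega>. Sd (j - i) (noise_diff i \<omega>)))\<^sup>2)"
  proof (rule L2_norm_sum_orthogonal)
    fix i l assume "i \<in> {..<j}" "l \<in> {..<j}" "i \<noteq> l"
    then show "expectation (\<lambda>\<omega>. Sd (j - i) (noise_diff i \<omega>) \<bullet>
        Sd (j - l) (noise_diff l \<omega>)) = 0"
      using orth[of i l] orth[of l i] by (cases "i < l") (auto simp: inner_commute)
  qed (use sq Sd_bound(1)[OF assms] in auto)
  also have "\<dots> \<le> (\<Sum>i<j. M\<^sup>2 * (dt * K\<^sup>2 * (err i)\<^sup>2))"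
  proof (rule sum_mono)
    fix i assume "i \<in> {..<j}"
    then have i: "i < j" by simp
    have "(L2_norm P (\<lambda>\<omega>. Sd (j - i) (noise_diff i \<omega>)))\<^sup>2 \<le> (M * L2_norm P (noise_diff i))\<^sup>2"
      using Sd_bound(2)[OF assms sq[OF i]] by (intro power_mono) auto
    also have "\<dots> \<le> M\<^sup>2 * (dt * K\<^sup>2 * (err i)\<^sup>2)"
      using noise_diff_le[of i] i assms by (simp add: power_mult_distrib mult_left_mono)
    finally show "(L2_norm P (\<lambda>\<omega>. Sd (j - i) (noise_diff i \<omega>)))\<^sup>2
        \<le> M\<^sup>2 * (dt * K\<^sup>2 * (err i)\<^sup>2)" .
  qed
  also have "\<dots> = M\<^sup>2 * K\<^sup>2 * dt * (\<Sum>i<j. (err i)\<^sup>2)" by (simp add: sum_distrib_left mult_ac)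
  finally show ?thesis .
qed

lemma remainder_square_integrable: "j \<le> J \<Longrightarrow> square_integrable_rv P (remainder j)"
  using Sd_bound(1)[of j "\<lambda>\<omega>. u \<omega> - v \<omega>" 0]
  by (simp add: remainder_def square_integrable_rv_diff adapted_L2_D(2)[OF UV_adapted(1)]
      adapted_L2_D(2)[OF UV_adapted(2)] adapted_L2_D(2)[OF u] adapted_L2_D(2)[OF v])

lemma remainder_le:
  assumes "j \<le> J"
  shows "(L2_norm P (remainder j))\<^sup>2 \<le> incr_const * dt * (\<Sum>i<j. (err i)\<^sup>2)"
proof -
  let ?a = "\<lambda>\<omega>. \<Sum>i<j. Sd (j - i) (dt *\<^sub>R drift_diff i \<omega>)"
  let ?b = "\<lambda>\<omega>. \<Sum>i<j. Sd (j - i) (noise_diff i \<omega>)"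
  have "square_integrable_rv P ?a"
    using assms by (intro square_integrable_rv_sum Sd_bound(1) square_integrable_rv_scaleR
        adapted_L2_D(2)[OF drift_diff_adapted]) auto
  moreover have "square_integrable_rv P ?b"
    using assms by (intro square_integrable_rv_sum Sd_bound(1) adapted_L2_D(2)[OF noise_diff_adapted]) auto
  ultimately have "L2_norm P (remainder j) \<le> L2_norm P ?a + L2_norm P ?b"
    unfolding remainder_eq by (rule L2_norm_triangle)
  then have "(L2_norm P (remainder j))\<^sup>2 \<le> (L2_norm P ?a + L2_norm P ?b)\<^sup>2"
    by (intro power_mono) auto
  also have "\<dots> \<le> 2 * (L2_norm P ?a)\<^sup>2 + 2 * (L2_norm P ?b)\<^sup>2"
    using norm_add_sq_le[of "L2_norm P ?a" "L2_norm P ?b"] by simp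
  also have "\<dots> \<le> 2 * (M\<^sup>2 * L\<^sup>2 * T * dt * (\<Sum>i<j. (err i)\<^sup>2)) + 2 * (M\<^sup>2 * K\<^sup>2 * dt * (\<Sum>i<j. (err i)\<^sup>2))"
    using drift_part_le[OF assms] noise_part_le[OF assms] by linarith
  also have "\<dots> = incr_const * dt * (\<Sum>i<j. (err i)\<^sup>2)"
    by (simp add: incr_const_def algebra_simps)
  finally show ?thesis .
qed

text \<open>Stability uniform in the number of fine steps. Gronwall is applied to the squares, since
  the orthogonal noise terms add in squares, and \<open>(1 + c) ^ j\<close> is at most the
  exponential of \<open>c * real j\<close>.\<close>

lemma err_le:
  assumes "j \<le> J"
  shows "(err j)\<^sup>2 \<le> growth_const * (err 0)\<^sup>2"
proof -
  let ?c = "2 * incr_const * dt"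
  have sq: "square_integrable_rv P (\<lambda>\<omega>. u \<omega> - v \<omega>)"
    by (rule adapted_L2_D(2)[OF adapted_L2_diff[OF u v]])
  have "(err i)\<^sup>2 \<le> 2 * M\<^sup>2 * (err 0)\<^sup>2 + ?c * (\<Sum>l<i. (err l)\<^sup>2)" if "i \<le> J" for i
  proof -
    let ?s = "\<lambda>\<omega>. Sd (i - 0) (u \<omega> - v \<omega>)"
    have "err i = L2_norm P (\<lambda>\<omega>. ?s \<omega> + remainder i \<omega>)" by (simp add: err_def remainder_def)
    also have "\<dots> \<le> L2_norm P ?s + L2_norm P (remainder i)"
      by (intro L2_norm_triangle Sd_bound(1) remainder_square_integrable that sq)
    also have "\<dots> \<le> M * err 0 + L2_norm P (remainder i)"
      using Sd_bound(2)[OF that sq, of 0] by (simp add: err_def U_def V_def)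
    finally have "(err i)\<^sup>2 \<le> (M * err 0 + L2_norm P (remainder i))\<^sup>2"
      by (intro power_mono) (auto simp: err_def)
    also have "\<dots> \<le> 2 * (M * err 0)\<^sup>2 + 2 * (L2_norm P (remainder i))\<^sup>2"
      using norm_add_sq_le[of "M * err 0" "L2_norm P (remainder i)"] by simp
    also have "\<dots> \<le> 2 * M\<^sup>2 * (err 0)\<^sup>2 + ?c * (\<Sum>l<i. (err l)\<^sup>2)"
      using remainder_le[OF that] by (simp add: power_mult_distrib)
    finally show ?thesis .
  qed
  from discrete_gronwall[OF _ this assms]
  have gronwall: "(err j)\<^sup>2 \<le> 2 * M\<^sup>2 * (err 0)\<^sup>2 * (1 + ?c) ^ j"
    using incr_const_nonneg dt by simp
  have "(1 + ?c) ^ j \<le> exp ?c ^ j"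
    using incr_const_nonneg dt by (intro power_mono exp_ge_add_one_self) simp
  also have "\<dots> = exp (2 * incr_const * (real j * dt))"
    by (simp add: exp_of_nat_mult[symmetric] mult_ac)
  also have "\<dots> \<le> exp (2 * incr_const * T)"
    using lag_bounds(2)[OF assms] incr_const_nonneg by (intro iffD2[OF exp_le_cancel_iff] mult_left_mono) auto
  finally have "2 * M\<^sup>2 * (err 0)\<^sup>2 * (1 + ?c) ^ j \<le> 2 * M\<^sup>2 * (err 0)\<^sup>2 * exp (2 * incr_const * T)"
    by (rule mult_left_mono) simp
  with gronwall show ?thesis by (simp add: growth_const_def mult_ac)
qed

text \<open>Stability turns the sum of the \<open>J\<close> squared errors into the length
  \<open>real J * dt\<close> of the coarse interval: the source of the gain
  \<open>sqrt dT\<close>.\<close>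

lemma remainder_final_le:
  "(L2_norm P (remainder J))\<^sup>2 \<le> incr_const * growth_const * (real J * dt) * (err 0)\<^sup>2"
proof -
  have "(L2_norm P (remainder J))\<^sup>2 \<le> incr_const * dt * (\<Sum>i<J. (err i)\<^sup>2)"
    by (rule remainder_le) simp
  also have "\<dots> \<le> incr_const * dt * (\<Sum>i<J. growth_const * (err 0)\<^sup>2)"
    using incr_const_nonneg dt by (intro mult_left_mono sum_mono err_le) auto
  finally show ?thesis by (simp add: mult_ac)
qed

end

lemma fine_prop_estimates:
  assumes dT: "0 < dT" and n: "real (Suc n) * dT \<le> T" and "1 \<le> J"
    and u: "adapted_L2 (real n * dT) u" and v: "adapted_L2 (real n * dT) v"
  defines "\<F> \<equiv> fine_prop integrator_step dT J n"
  shows "adapted_L2 (real (Suc n) * dT) (\<F> u)"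
    "L2_norm P (\<lambda>\<omega>. \<F> u \<omega> - \<F> v \<omega>) \<le> sqrt growth_const * L2_norm P (\<lambda>\<omega>. u \<omega> - v \<omega>)"
    "L2_norm P (\<lambda>\<omega>. (\<F> u \<omega> - \<F> v \<omega>) - S dT (u \<omega> - v \<omega>))
      \<le> sqrt (incr_const * growth_const) * sqrt dT * L2_norm P (\<lambda>\<omega>. u \<omega> - v \<omega>)"
proof -
  define dt where "dt = dT / real J"
  have dt: "0 < dt" "real J * dt = dT" using dT \<open>1 \<le> J\<close> by (simp_all add: dt_def)
  have t0: "0 \<le> real n * dT" using dT by simp
  have te: "real n * dT + real J * dt = real (Suc n) * dT" unfolding dt(2) by (simp add: algebra_simps)
  then have te': "real n * dT + real J * dt \<le> T" using n by simp
  have \<F>: "\<F> = fine_steps integrator_step (real n * dT) dt J"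
    by (simp add: \<F>_def fine_prop_def dt_def fun_eq_iff)
  show "adapted_L2 (real (Suc n) * dT) (\<F> u)"
    using fine_steps_adapted[OF t0 dt(1) te' u v u, of J] 
    unfolding \<F> node_def[OF t0 dt(1) te' u v] te by simp
  have "(L2_norm P (\<lambda>\<omega>. \<F> u \<omega> - \<F> v \<omega>))\<^sup>2 \<le> growth_const * (L2_norm P (\<lambda>\<omega>. u \<omega> - v \<omega>))\<^sup>2"
    using err_le[OF t0 dt(1) te' u v, of J] by (simp add: \<F> err_def[OF t0 dt(1) te' u v] U_def[OF t0 dt(1) te' u v] V_def[OF t0 dt(1) te' u v])
  then have "sqrt ((L2_norm P (\<lambda>\<omega>. \<F> u \<omega> - \<F> v \<omega>))\<^sup>2) \<le> sqrt (growth_const * (L2_norm P (\<lambda>\<omega>. u \<omega> - v \<omega>))\<^sup>2)"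
    by (rule real_sqrt_le_mono)
  then show "L2_norm P (\<lambda>\<omega>. \<F> u \<omega> - \<F> v \<omega>) \<le> sqrt growth_const * L2_norm P (\<lambda>\<omega>. u \<omega> - v \<omega>)"
    by (simp add: real_sqrt_mult)
  have "(L2_norm P (\<lambda>\<omega>. (\<F> u \<omega> - \<F> v \<omega>) - S dT (u \<omega> - v \<omega>)))\<^sup>2
      \<le> incr_const * growth_const * dT * (L2_norm P (\<lambda>\<omega>. u \<omega> - v \<omega>))\<^sup>2"
    using remainder_final_le[OF t0 dt(1) te' u v]
    by (simp add: \<F> dt(2) err_def[OF t0 dt(1) te' u v] U_def[OF t0 dt(1) te' u v] V_def[OF t0 dt(1) te' u v] remainder_def[OF t0 dt(1) te' u v] Sd_def[OF t0 dt(1) te' u v])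
  then have "sqrt ((L2_norm P (\<lambda>\<omega>. (\<F> u \<omega> - \<F> v \<omega>) - S dT (u \<omega> - v \<omega>)))\<^sup>2)
      \<le> sqrt (incr_const * growth_const * dT * (L2_norm P (\<lambda>\<omega>. u \<omega> - v \<omega>))\<^sup>2)"
    by (rule real_sqrt_le_mono)
  then show "L2_norm P (\<lambda>\<omega>. (\<F> u \<omega> - \<F> v \<omega>) - S dT (u \<omega> - v \<omega>))
      \<le> sqrt (incr_const * growth_const) * sqrt dT * L2_norm P (\<lambda>\<omega>. u \<omega> - v \<omega>)"
    by (simp add: real_sqrt_mult)
qed

end

section \<open>The parareal iteration\<close>

text \<open>The coarse propagator is the fine one with a single step, so all estimates apply to it
  with the same constants.\<close>

lemma coarse_prop_eq_fine_prop: "coarse_prop step dT = fine_prop step dT 1"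
  by (simp add: fun_eq_iff coarse_prop_def fine_prop_def algebra_simps)

context exp_integrator
begin

text \<open>The 2 counts the remainders of the fine and of the coarse propagator;
  \<open>real N * sqrt growth_const ^ N\<close> is their accumulation over \<open>N\<close>
  intervals.\<close>

definition rate_const :: "nat \<Rightarrow> real" where
  "rate_const N = 2 * sqrt (incr_const * growth_const) * (real N * sqrt growth_const ^ N)"

lemma rate_const_nonneg: "0 \<le> rate_const N"
  using incr_const_nonneg growth_const_ge_1 by (simp add: rate_const_def)

context
  fixes N J :: nat and dT :: real and u0 :: "'w \<Rightarrow> 'h"
  assumes N: "1 \<le> N" and dT: "0 < dT" "real N * dT \<le> T" and J: "1 \<le> J"
    and u0: "adapted_L2 0 u0"
begin

abbreviation (input) "\<F> \<equiv> fine_prop integrator_step dT J"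
abbreviation (input) "\<G> \<equiv> coarse_prop integrator_step dT"
abbreviation (input) "par \<equiv> parareal \<G> \<F> u0"
abbreviation (input) "ref \<equiv> reference \<F> u0"

definition "par_err k n = L2_norm P (\<lambda>\<omega>. par k n \<omega> - ref n \<omega>)"

definition "max_err k = (SUP n\<in>{1..N}. par_err k n)"

lemma node_in_range:
  assumes "n < N"
  shows "real (Suc n) * dT \<le> T"
proof -
  have "real (Suc n) * dT \<le> real N * dT" using assms dT(1) by (intro mult_right_mono) auto
  then show ?thesis using dT(2) by linarith
qed

lemma fine_adapted:
  "n < N \<Longrightarrow> adapted_L2 (real n * dT) u \<Longrightarrow> adapted_L2 (real (Suc n) * dT) (\<F> n u)"
  by (rule fine_prop_estimates(1)[OF dT(1) node_in_range J])

lemma coarse_adapted: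
  "n < N \<Longrightarrow> adapted_L2 (real n * dT) u \<Longrightarrow> adapted_L2 (real (Suc n) * dT) (\<G> n u)"
  unfolding coarse_prop_eq_fine_prop by (rule fine_prop_estimates(1)[OF dT(1) node_in_range]) auto

lemma ref_adapted: "n \<le> N \<Longrightarrow> adapted_L2 (real n * dT) (ref n)"
proof (induction n)
  case (Suc n)
  then show ?case using fine_adapted[of n "ref n"] by simp
qed (simp add: u0)

lemma par_adapted: "n \<le> N \<Longrightarrow> adapted_L2 (real n * dT) (par k n)"
proof (induction n arbitrary: k)
  case (Suc n)
  then have n: "n < N" and IH: "adapted_L2 (real n * dT) (par k n)" for k by simp_all
  show ?case
  proof (cases k)
    case 0
    then show ?thesis using coarse_adapted[OF n IH[of 0]] by simp
  next
    case (Suc l)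
    show ?thesis
      unfolding Suc parareal.simps
      by (intro adapted_L2_diff adapted_L2_add coarse_adapted fine_adapted n IH)
  qed
qed (simp add: u0)

lemma par_err_0: "par_err k 0 = 0"
  by (simp add: par_err_def)

text \<open>With \<open>?r\<close> advanced by the fine propagator, adding and subtracting its
  coarse image splits the error into \<open>a + f - g\<close>. Stability bounds \<open>a\<close>,
  the remainder estimate bounds \<open>f\<close> and \<open>g\<close>, and their terms
  \<open>S dT (?u - ?r)\<close> cancel.\<close>

lemma par_err_Suc:
  assumes n: "n < N"
  shows "par_err (Suc k) (Suc n) \<le> sqrt growth_const * par_err (Suc k) n +
    2 * sqrt (incr_const * growth_const) * sqrt dT * par_err k n"
proof -
  let ?u = "par k n" and ?w = "par (Suc k) n" and ?r = "ref n"
  have ad: "adapted_L2 (real n * dT) ?u" "adapted_L2 (real n * dT) ?w" "adapted_L2 (real n * dT) ?r"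
    using n by (auto intro!: par_adapted ref_adapted simp del: parareal.simps)
  note est_F = fine_prop_estimates[OF dT(1) node_in_range[OF n] J]
  note est_G = fine_prop_estimates[OF dT(1) node_in_range[OF n] order_refl,
      folded coarse_prop_eq_fine_prop]
  define a where "a = (\<lambda>\<omega>. \<G> n ?w \<omega> - \<G> n ?r \<omega>)"
  define f where "f = (\<lambda>\<omega>. (\<F> n ?u \<omega> - \<F> n ?r \<omega>) - S dT (?u \<omega> - ?r \<omega>))"
  define g where "g = (\<lambda>\<omega>. (\<G> n ?u \<omega> - \<G> n ?r \<omega>) - S dT (?u \<omega> - ?r \<omega>))"
  have sq_S: "square_integrable_rv P (\<lambda>\<omega>. S dT (?u \<omega> - ?r \<omega>))"
    using dT(1) by (intro S_square_integrable adapted_L2_D(2)[OF adapted_L2_diff[OF ad(1,3)]]) simp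
  have sq: "square_integrable_rv P a" "square_integrable_rv P f" "square_integrable_rv P g"
    unfolding a_def f_def g_def
    by (intro square_integrable_rv_diff sq_S adapted_L2_D(2)[OF fine_adapted[OF n]]
        adapted_L2_D(2)[OF coarse_adapted[OF n]] ad)+
  have "(\<lambda>\<omega>. par (Suc k) (Suc n) \<omega> - ref (Suc n) \<omega>) = (\<lambda>\<omega>. (a \<omega> + f \<omega>) + (-1) *\<^sub>R g \<omega>)"
    by (simp add: a_def f_def g_def algebra_simps)
  then have "par_err (Suc k) (Suc n) = L2_norm P (\<lambda>\<omega>. (a \<omega> + f \<omega>) + (-1) *\<^sub>R g \<omega>)"
    unfolding par_err_def by (rule arg_cong)
  also have "\<dots> \<le> L2_norm P (\<lambda>\<omega>. a \<omega> + f \<omega>) + L2_norm P (\<lambda>\<omega>. (-1) *\<^sub>R g \<omega>)"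
    by (intro L2_norm_triangle square_integrable_rv_add square_integrable_rv_scaleR sq)
  also have "\<dots> \<le> L2_norm P a + L2_norm P f + L2_norm P g"
    using L2_norm_triangle[OF sq(1,2)] unfolding L2_norm_scaleR by simp
  finally show ?thesis
    using est_G(2)[OF ad(2,3)] est_F(3)[OF ad(1,3)] est_G(3)[OF ad(1,3)]
    unfolding par_err_def a_def f_def g_def by simp
qed

text \<open>The supremum starts at \<open>n = 1\<close>, while the recursion also refers to
  \<open>n = 0\<close>. There the error is 0, and \<open>1 \<le> N\<close> supplies an index showing
  that the supremum is nonnegative.\<close>

lemma par_err_le_max_err:
  assumes "n \<le> N"
  shows "par_err k n \<le> max_err k"
proof -
  have le: "par_err k i \<le> max_err k" if "i \<in> {1..N}" for i
    unfolding max_err_def using that by (intro cSUP_upper) auto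
  show ?thesis
  proof (cases "n = 0")
    case True
    have "0 \<le> par_err k 1" by (simp add: par_err_def)
    then show ?thesis using le[of 1] N True by (simp add: par_err_0)
  qed (use le assms in simp)
qed

lemma max_err_nonneg: "0 \<le> max_err k"
  using par_err_le_max_err[of 0 k] by (simp add: par_err_0)

lemma max_err_Suc: "max_err (Suc k) \<le> rate_const N * sqrt dT * max_err k"
proof -
  define a where "a = sqrt growth_const"
  define c where "c = 2 * sqrt (incr_const * growth_const) * sqrt dT * max_err k"
  have a: "1 \<le> a" using growth_const_ge_1 by (simp add: a_def)
  have c: "0 \<le> c"
    using incr_const_nonneg growth_const_ge_1 dT max_err_nonneg by (simp add: c_def)
  \<comment> \<open>The recursion has the form \<open>x (Suc n) \<le> a * x n + c\<close> with
    \<open>x 0 = 0\<close>; its geometric sum is at most \<open>c * (real n * a ^ n)\<close> because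
    \<open>1 \<le> a\<close>.\<close>
  have "par_err (Suc k) n \<le> c * (real n * a ^ n)" if "n \<le> N" for n
    using that
  proof (induction n)
    case (Suc n)
    have "par_err (Suc k) (Suc n) \<le> a * par_err (Suc k) n + c"
      using par_err_Suc[of n k] Suc.prems incr_const_nonneg growth_const_ge_1 dT
        mult_left_mono[OF par_err_le_max_err[of n k], of "2 * sqrt (incr_const * growth_const) * sqrt dT"]
      by (simp add: a_def c_def)
    also have "\<dots> \<le> a * (c * (real n * a ^ n)) + c"
      using Suc a by (intro add_right_mono mult_left_mono) auto
    also have "\<dots> \<le> a * (c * (real n * a ^ n)) + c * a ^ Suc n"
      using c one_le_power[OF a, of "Suc n"] by (intro add_left_mono) (simp add: mult_left_le mult_le_cancel_left1)
    also have "\<dots> = c * (real (Suc n) * a ^ Suc n)" by (simp add: algebra_simps)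
    finally show ?case .
  qed (simp add: par_err_0)
  also have "c * (real n * a ^ n) \<le> c * (real N * a ^ N)" if "n \<le> N" for n
    using that a c by (intro mult_left_mono mult_mono power_increasing) auto
  finally have "par_err (Suc k) n \<le> c * (real N * a ^ N)" if "n \<le> N" for n using that by blast
  then have "max_err (Suc k) \<le> c * (real N * a ^ N)"
    unfolding max_err_def using N by (intro cSUP_least) auto
  then show ?thesis by (simp add: rate_const_def a_def c_def mult_ac)
qed

lemma max_err_le: "max_err k \<le> rate_const N ^ k * dT powr (real k / 2) * max_err 0"
proof -
  have "max_err k \<le> (rate_const N * sqrt dT) ^ k * max_err 0"
  proof (induction k)
    case (Suc k)
    have "max_err (Suc k) \<le> (rate_const N * sqrt dT) * max_err k" by (rule max_err_Suc)
    also have "\<dots> \<le> (rate_const N * sqrt dT) * ((rate_const N * sqrt dT) ^ k * max_err 0)"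
      using Suc rate_const_nonneg dT by (intro mult_left_mono) auto
    finally show ?case by (simp add: mult_ac)
  qed simp
  moreover have "sqrt dT ^ k = dT powr (real k / 2)"
    using dT(1) by (simp add: powr_half_sqrt[symmetric] powr_realpow[symmetric] powr_powr)
  ultimately show ?thesis by (simp add: power_mult_distrib)
qed

end

lemma parareal_converges:
  assumes "1 \<le> N"
  shows "\<exists>c>0. \<forall>u0 dT J. hyp_A1 P \<FF> u0 \<longrightarrow> 0 < dT \<longrightarrow> real N * dT \<le> T \<longrightarrow> 1 \<le> J \<longrightarrow>
     (let u = parareal (coarse_prop integrator_step dT) (fine_prop integrator_step dT J) u0;
          u_ref = reference (fine_prop integrator_step dT J) u0
      in (\<forall>n\<in>{1..N}. square_integrable_rv P (u k n) \<and> square_integrable_rv P (u 0 n) \<and>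
                     square_integrable_rv P (u_ref n)) \<and>
         (SUP n\<in>{1..N}. L2_norm P (\<lambda>\<omega>. u k n \<omega> - u_ref n \<omega>))
           \<le> c * dT powr (real k / 2) * (SUP n\<in>{1..N}. L2_norm P (\<lambda>\<omega>. u 0 n \<omega> - u_ref n \<omega>)))"
\<comment> \<open>The summand 1 makes the constant strictly positive: \<open>rate_const N\<close> is
  0 when \<open>L\<close> and \<open>K\<close> both vanish.\<close>
proof (intro exI[of _ "(rate_const N + 1) ^ k"] conjI allI impI)
  show "0 < (rate_const N + 1) ^ k" using rate_const_nonneg[of N] by (intro zero_less_power) simp
  fix u0 :: "'w \<Rightarrow> 'h" and dT J
  assume A1: "hyp_A1 P \<FF> u0" and dT: "0 < dT" "real N * dT \<le> T" and J: "1 \<le> (J::nat)"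
  have u0: "adapted_L2 0 u0" using A1 by (simp add: hyp_A1_def adapted_L2_def)
  note ctx = assms dT J u0
  have "max_err N J dT u0 k \<le> rate_const N ^ k * dT powr (real k / 2) * max_err N J dT u0 0"
    by (rule max_err_le[OF ctx])
  also have "\<dots> \<le> (rate_const N + 1) ^ k * dT powr (real k / 2) * max_err N J dT u0 0"
    using rate_const_nonneg[of N] max_err_nonneg[OF ctx, of 0]
    by (intro mult_right_mono power_mono) auto
  finally show "let u = parareal (coarse_prop integrator_step dT) (fine_prop integrator_step dT J) u0;
      u_ref = reference (fine_prop integrator_step dT J) u0
    in (\<forall>n\<in>{1..N}. square_integrable_rv P (u k n) \<and> square_integrable_rv P (u 0 n) \<and>
          square_integrable_rv P (u_ref n)) \<and>
       (SUP n\<in>{1..N}. L2_norm P (\<lambda>\<omega>. u k n \<omega> - u_ref n \<omega>))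
         \<le> (rate_const N + 1) ^ k * dT powr (real k / 2) *
           (SUP n\<in>{1..N}. L2_norm P (\<lambda>\<omega>. u 0 n \<omega> - u_ref n \<omega>))"
    using adapted_L2_D(2)[OF par_adapted[OF ctx]] adapted_L2_D(2)[OF ref_adapted[OF ctx]]
    unfolding Let_def max_err_def[OF ctx] par_err_def[OF ctx] by auto
qed

end

text \<open>The constant is fixed before \<open>u0\<close>, \<open>dT\<close> and \<open>J\<close>,
  and \<open>real N * dT \<le> T\<close> includes the case of equality. Square integrability is part
  of the conclusion because the Bochner integral of a non-integrable function is 0, so a bare
  inequality between norms could be meaningless.\<close>

theorem theorem2:
  fixes D :: "(real^3) set" and \<epsilon> \<mu> :: "real^3 \<Rightarrow> real"
    and E H :: "'h::{real_inner, banach, second_countable_topology} \<Rightarrow> real^3 \<Rightarrow> real^3"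
    and S :: "real \<Rightarrow> 'h \<Rightarrow> 'h" and \<sigma> T C b :: real
    and P :: "'w measure" and \<FF> :: "real \<Rightarrow> 'w measure"
    and e :: "nat \<Rightarrow> 'h" and lam :: "nat \<Rightarrow> real" and Q :: "'h \<Rightarrow> 'h"
    and \<beta> :: "nat \<Rightarrow> real \<Rightarrow> 'w \<Rightarrow> real" and W :: "real \<Rightarrow> 'w \<Rightarrow> 'h"
    and F :: "real \<Rightarrow> 'h \<Rightarrow> 'h" and B :: "real \<Rightarrow> 'h \<Rightarrow> 'h \<Rightarrow> 'h"
    and N k :: nat
  assumes domain: "open D" "connected D" "D \<noteq> {}"
    and medium: "bounded_positive_coeff D \<epsilon>" "bounded_positive_coeff D \<mu>"
    and space: "em_space D \<epsilon> \<mu> E H"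
    and semigroup: "0 \<le> \<sigma>" "C0_semigroup S" "generator S = minus_scalar (maxwell D \<epsilon> \<mu> E H) \<sigma>"
    and probability: "prob_space P" "0 < T" "filtration_on P T \<FF>"
    and noise: "complete_orthonormal e" "covariance_operator e lam Q" "Q_wiener P T \<FF> e lam \<beta> W"
    and A2: "hyp_A2 T C F"
    and A3: "hyp_A3 e lam T C B"
    and A4: "0 \<le> b" "b \<le> 1" "hyp_A4 (maxwell D \<epsilon> \<mu> E H) e lam b"
    and N: "1 \<le> N"
  shows "\<exists>C\<^sub>T\<^sub>N>0. \<forall>u0 dT J.
     hyp_A1 P \<FF> u0 \<longrightarrow> 0 < dT \<longrightarrow> real N * dT \<le> T \<longrightarrow> 1 \<le> J \<longrightarrow>
     (let step = exp_step P \<FF> e lam W S F B;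
          u = parareal (coarse_prop step dT) (fine_prop step dT J) u0;
          u_ref = reference (fine_prop step dT J) u0
      in (\<forall>n\<in>{1..N}. square_integrable_rv P (u k n) \<and> square_integrable_rv P (u 0 n) \<and>
                     square_integrable_rv P (u_ref n)) \<and>
         (SUP n\<in>{1..N}. L2_norm P (\<lambda>\<omega>. u k n \<omega> - u_ref n \<omega>))
           \<le> C\<^sub>T\<^sub>N * dT powr (real k / 2) * (SUP n\<in>{1..N}. L2_norm P (\<lambda>\<omega>. u 0 n \<omega> - u_ref n \<omega>)))"
proof -
  obtain M where M: "1 \<le> M" "\<And>t x. 0 \<le> t \<Longrightarrow> t \<le> T \<Longrightarrow> norm (S t x) \<le> M * norm x"
    using C0_semigroup_bounded[OF semigroup(2), of T] by blast
  \<comment> \<open>The absolute value makes \<open>K\<close> nonnegative at once, without first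
    proving that the series behind \<open>hs_norm\<close> converges.\<close>
  define K where "K = \<bar>C * hs_norm e (sqrt_op e lam)\<bar>"
  have K: "C * hs_norm e (sqrt_op e lam) * x \<le> K * x" if "0 \<le> x" for x
    unfolding K_def by (intro mult_right_mono abs_ge_self that)
  interpret prob_space P by fact
  have "0 \<le> C"
  proof -
    have "norm (F 0 0) \<le> C * (1 + norm (0::'h))"
      using A2 \<open>0 < T\<close> unfolding hyp_A2_def by (metis atLeastAtMost_iff less_imp_le order_refl)
    then have "norm (F 0 0) \<le> C" by simp
    then show ?thesis using norm_ge_zero[of "F 0 0"] by linarith
  qed
  interpret exp_integrator P T \<FF> e lam \<beta> W S F B M C K
  proof unfold_locales
    show "filtration_on P T \<FF>" "Q_wiener P T \<FF> e lam \<beta> W" "C0_semigroup S" by fact+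
    show "e m \<bullet> e n = (if m = n then 1 else 0)" for m n
      using noise(1) by (simp add: complete_orthonormal_def)
    show "0 \<le> lam n" for n using noise(2) by (simp add: covariance_operator_def)
    show "0 \<le> T" using \<open>0 < T\<close> by simp
    show "1 \<le> M" "0 \<le> C" by fact+
    show "norm (S t x) \<le> M * norm x" if "0 \<le> t" "t \<le> T" for t x using M(2) that by simp
    show "0 \<le> K" by (simp add: K_def)
    fix t u v assume t: "0 \<le> t" "t \<le> T"
    have "norm (F t u - F t v) \<le> C * (\<bar>t - t\<bar> + norm (u - v))"
      using A2 t unfolding hyp_A2_def by (meson atLeastAtMost_iff)
    then show "norm (F t u - F t v) \<le> C * norm (u - v)" by simp
    show "B t u \<in> HS0 e lam" using A3 t unfolding hyp_A3_def by simp
    have "hs0_norm e lam (B t u) \<le> C * hs_norm e (sqrt_op e lam) * sqrt (1 + (norm u)\<^sup>2)"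
      using A3 t unfolding hyp_A3_def by simp
    also have "\<dots> \<le> K * sqrt (1 + (norm u)\<^sup>2)" by (rule K) simp
    finally show "hs0_norm e lam (B t u) \<le> K * sqrt (1 + (norm u)\<^sup>2)" .
    have "hs0_norm e lam (\<lambda>x. B t u x - B t v x)
        \<le> C * hs_norm e (sqrt_op e lam) * (\<bar>t - t\<bar> + norm (u - v))"
      using A3 t unfolding hyp_A3_def by (meson atLeastAtMost_iff)
    also have "\<dots> \<le> K * norm (u - v)" using K[of "norm (u - v)"] by simp
    finally show "hs0_norm e lam (\<lambda>x. B t u x - B t v x) \<le> K * norm (u - v)" .
  qed
  show ?thesis using parareal_converges[OF N, of k] unfolding Let_def .
qed

end
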